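(* The maps $x\mapsto x^h$ ($h\in H$) defined in the context give a faithful action $$2^{12}.M_{24}=\operatorname{Aut}_{\rm St}(P)=H\hookrightarrow\operatorname{Aut}_{\rm sl}(A,* )$$ by semilinear algebra automorphisms. Every $h\in H^+\cong2^{11}.M_{24}$ acts $\mathbb E$-linearly, and every element of the other coset $H\setminus H^+$ acts conjugate-linearly.
   Context: Code and loop. $I$ is a set with $|I|=24$; $\mathcal C\subseteq\mathbb F_2^I$ is the extended binary Golay code (words identified with supports); $\mathbf 1$ is the all-one word; octads are the words of weight $8$. $P$ is Parker's loop: the Moufang loop with a central element $-1$ of order $2$ and a surjective homomorphism $P\to\mathcal C$, $d\mapsto\bar d$, with kernel $\{\pm1\}$, such that $d^2=(-1)^{|\bar d|/4}$, $de=(-1)^{|\bar d\cap\bar e|/2}ed$, $(de)f=(-1)^{|\bar d\cap\bar e\cap\bar f|}d(ef)$. $-d$ means $(-1)d$. $\Omega\in P$ is a fixed lift of $\mathbf 1$ (it is central of order two). Algebra. $\mathbb E=\mathbb Q(\omega)$ with $\omega$ a primitive cube root of unity, $\vartheta=\omega-\bar\omega=\sqrt{-3}$. $A=U\oplus W$, where $U$ has $\mathbb E$-basis $u_i$ ($i\in I$) and $W$ is the $\mathbb E$-space spanned by symbols $x_d$ ($d\in P$, $\bar d$ an octad) subject only to $x_{-d}=-x_d$. The product $*$ is commutative and conjugate-bilinear, $(\alpha x+\beta y)*z=\bar\alpha(x*z)+\bar\beta(y*z)$, and is determined by: $128u_i*u_i=-81u_i+15\sum_{j\ne i}u_j$;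 $128u_i*u_j=15u_i+15u_j-\sum_{k\notin\{i,j\}}u_k$ ($i\ne j$); $16u_i*x_d=3x_d$ if $i\in\bar d$ and $=-x_d$ if $i\notin\bar d$; $2x_d*x_d=3\sum_{i\in\bar d}u_i-\sum_{i\notin\bar d}u_i$; and for $d\ne\pm f$: $2x_d*x_f=x_{df}$ if $|\bar d\cap\bar f|=4$, $=\vartheta x_{df\Omega}$ if $\bar d\cap\bar f=\varnothing$, $=0$ if $|\bar d\cap\bar f|=2$. $\operatorname{Aut}_{\rm sl}(A,* )$ is the group of bijections $g:A\to A$ that are $\mathbb E$-linear or $\mathbb E$-conjugate-linear and satisfy $g(x*y)=g(x)*g(y)$. Base group. $H=\operatorname{Aut}_{\rm St}(P)$ is the group of automorphisms of $P$ inducing on $\mathcal C$ a coordinate permutation preserving $\mathcal C$ (written on the right, $d\mapsto d^h$), with induced permutation $\pi_h\in M_{24}=\operatorname{Aut}(\mathcal C)$. It is an extension (of shape $2^{12}.M_{24}$) of $M_{24}$ by the cocode $\mathcal C^*=\mathbb F_2^I/\mathcal C$. Define $\varepsilon(h)\in\mathbb F_2$ by $\Omega^h=(-1)^{\varepsilon(h)}\Omega$; $\varepsilon$ is a homomorphism and $H^+=\ker\varepsilon$ has index two. The right action of $H$ on $A$ is $u_i^h=u_{\pi_h(i)}$, $x_d^h=x_{d^h}$, with $(\lambda x)^h=\lambda x^h$ if $\varepsilon(h)=0$ and $(\lambda x)^h=\bar\lambda x^h$ if $\varepsilon(h)=1$ (the corresponding embedding in the automorphism group under composition sends $h$ to $x\mapsto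 x^{h^{-1}}$). *)

theory Defs
  imports
    Complex_Main
    "HOL-Library.Function_Algebras"
    "HOL-Library.Product_Plus"
    "HOL-Library.Z2"
    "HOL-Library.Cardinality"
    "HOL-Algebra.Group_Action"
begin

section \<open>The field \<open>\<rat>(\<omega>)\<close>\<close>

definition omega_complex :: complex where
  "omega_complex = cis (2 * pi / 3)"

lemma omega_complex_eq: "omega_complex = Complex (- 1 / 2) (sqrt 3 / 2)"
  by (simp add: omega_complex_def complex_eq_iff cos_120 sin_120)

lemma omega_complex_sq: "omega_complex * omega_complex = - 1 - omega_complex"
  by (simp add: omega_complex_eq complex_eq_iff)

lemma cnj_omega_complex: "cnj omega_complex = - 1 - omega_complex"
  by (simp add: omega_complex_eq complex_eq_iff)

lemma cnj_of_rat [simp]: "cnj (of_rat a) = of_rat a"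
  by (cases a) (simp add: of_rat_rat)

lemma eis_mult_complex:
  "(of_rat a + of_rat b * omega_complex) * (of_rat c + of_rat d * omega_complex)
    = of_rat (a * c - b * d) + of_rat (a * d + b * c - b * d) * omega_complex"
proof -
  have "(of_rat a + of_rat b * omega_complex) * (of_rat c + of_rat d * omega_complex)
    = of_rat a * of_rat c + (of_rat a * of_rat d + of_rat b * of_rat c) * omega_complex
      + of_rat b * of_rat d * (omega_complex * omega_complex)"
    by (simp add: algebra_simps)
  then show ?thesis
    unfolding omega_complex_sq by (simp add: of_rat_add of_rat_diff of_rat_mult algebra_simps)
qed

lemma eis_cnj_complex:
  "cnj (of_rat a + of_rat b * omega_complex) = of_rat (a - b) + of_rat (- b) * omega_complex"
  by (simp add: cnj_omega_complex of_rat_diff of_rat_minus algebra_simps)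

definition eis_set :: "complex set" where
  "eis_set = {of_rat a + of_rat b * omega_complex | a b. True}"

lemma eis_set_rat: "of_rat a \<in> eis_set"
  unfolding eis_set_def by (rule CollectI, rule exI[of _ a], rule exI[of _ 0]) simp

lemma eis_set_add: "x \<in> eis_set \<Longrightarrow> y \<in> eis_set \<Longrightarrow> x + y \<in> eis_set"
proof -
  assume "x \<in> eis_set" "y \<in> eis_set"
  then obtain a b c d where "x = of_rat a + of_rat b * omega_complex"
    "y = of_rat c + of_rat d * omega_complex"
    unfolding eis_set_def by blast
  then have "x + y = of_rat (a + c) + of_rat (b + d) * omega_complex"
    by (simp add: of_rat_add algebra_simps)
  then show ?thesis unfolding eis_set_def by blast
qed

lemma eis_set_mult: "x \<in> eis_set \<Longrightarrow> y \<in> eis_set \<Longrightarrow> x * y \<in> eis_set"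
  using eis_mult_complex unfolding eis_set_def by blast

lemma eis_set_cnj: "x \<in> eis_set \<Longrightarrow> cnj x \<in> eis_set"
  using eis_cnj_complex unfolding eis_set_def by blast

lemma eis_set_minus: "x \<in> eis_set \<Longrightarrow> - x \<in> eis_set"
  using eis_set_mult[OF eis_set_rat[of "- 1"], of x] by (simp add: of_rat_minus)

lemma eis_set_diff: "x \<in> eis_set \<Longrightarrow> y \<in> eis_set \<Longrightarrow> x - y \<in> eis_set"
  using eis_set_add[OF _ eis_set_minus] by fastforce

lemma eis_set_inverse:
  assumes "x \<in> eis_set"
  shows "inverse x \<in> eis_set"
proof -
  obtain a b where x: "x = of_rat a + of_rat b * omega_complex"
    using assms unfolding eis_set_def by blast
  have n: "x * cnj x = of_rat (a * a - a * b + b * b)"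
    unfolding x eis_cnj_complex eis_mult_complex by (simp add: algebra_simps)
  have "inverse x = cnj x * inverse (x * cnj x)"
    by (cases "x = 0") (simp_all add: field_simps)
  also have "\<dots> = cnj x * of_rat (inverse (a * a - a * b + b * b))"
    unfolding n of_rat_inverse ..
  finally show ?thesis using eis_set_mult[OF eis_set_cnj[OF assms] eis_set_rat] by simp
qed

typedef eis = eis_set
  morphisms complex_of_eis Abs_eis
  using eis_set_rat by blast

setup_lifting type_definition_eis

instantiation eis :: field
begin

lift_definition zero_eis :: eis is 0
  using eis_set_rat[of 0] by simp
lift_definition one_eis :: eis is 1
  using eis_set_rat[of 1] by simp
lift_definition plus_eis :: "eis \<Rightarrow> eis \<Rightarrow> eis" is "(+)"
  by (rule eis_set_add)
lift_definition minus_eis :: "eis \<Rightarrow> eis \<Rightarrow> eis" is "(-)"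
  by (rule eis_set_diff)
lift_definition uminus_eis :: "eis \<Rightarrow> eis" is uminus
  by (rule eis_set_minus)
lift_definition times_eis :: "eis \<Rightarrow> eis \<Rightarrow> eis" is "(*)"
  by (rule eis_set_mult)
lift_definition inverse_eis :: "eis \<Rightarrow> eis" is inverse
  by (rule eis_set_inverse)
definition divide_eis :: "eis \<Rightarrow> eis \<Rightarrow> eis" where "divide_eis x y = x * inverse y"

instance
  by standard (transfer; simp add: algebra_simps divide_eis_def; fail
    | simp add: divide_eis_def)+

end

instance eis :: field_char_0
proof
  have "complex_of_eis (of_nat n) = of_nat n" for n
    by (induction n) (simp_all add: zero_eis.rep_eq plus_eis.rep_eq one_eis.rep_eq)
  then show "inj (of_nat :: nat \<Rightarrow> eis)"
    by (metis injI of_nat_eq_iff)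
qed

lift_definition eis_cnj :: "eis \<Rightarrow> eis" is cnj
  by (rule eis_set_cnj)

lemma eis_set_omega: "omega_complex \<in> eis_set"
  unfolding eis_set_def by (rule CollectI, rule exI[of _ 0], rule exI[of _ 1]) simp

lift_definition eis_omega :: eis is omega_complex
  by (rule eis_set_omega)

definition eis_theta :: eis where
  "eis_theta = eis_omega - eis_cnj eis_omega"

lemma complex_of_eis_theta: "complex_of_eis eis_theta = Complex 0 (sqrt 3)"
  unfolding eis_theta_def
  by (simp add: minus_eis.rep_eq eis_cnj.rep_eq eis_omega.rep_eq
      omega_complex_eq complex_eq_iff)

lemma eis_theta_sq: "eis_theta * eis_theta = - 3"
proof -
  have 3: "complex_of_eis 3 = 3"
  proof -
    have "(3 :: eis) = 1 + 1 + 1" by simp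
    then show ?thesis by (simp only: plus_eis.rep_eq one_eis.rep_eq) simp
  qed
  have "complex_of_eis (eis_theta * eis_theta) = complex_of_eis (- 3)"
    by (simp add: times_eis.rep_eq uminus_eis.rep_eq complex_of_eis_theta 3 complex_eq_iff)
  then show ?thesis by (simp add: complex_of_eis_inject)
qed

lemma eis_cnj_simps [simp]:
  "eis_cnj 0 = 0" "eis_cnj 1 = 1" "eis_cnj (x + y) = eis_cnj x + eis_cnj y"
  "eis_cnj (x - y) = eis_cnj x - eis_cnj y" "eis_cnj (- x) = - eis_cnj x"
  "eis_cnj (x * y) = eis_cnj x * eis_cnj y" "eis_cnj (eis_cnj x) = x"
  by (transfer; simp)+

lemma eis_cnj_numeral [simp]: "eis_cnj (numeral n) = numeral n"
  by (induction n) (simp_all only: numeral.simps eis_cnj_simps)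

lemma eis_cnj_inverse [simp]: "eis_cnj (inverse x) = inverse (eis_cnj x)"
  by transfer simp

lemma eis_cnj_divide [simp]: "eis_cnj (x / y) = eis_cnj x / eis_cnj y"
  by (simp add: divide_eis_def)

lemma eis_cnj_sum: "eis_cnj (sum f S) = (\<Sum>s\<in>S. eis_cnj (f s))"
  by (induction S rule: infinite_finite_induct) simp_all

lemma eis_cnj_theta [simp]: "eis_cnj eis_theta = - eis_theta"
  by (simp add: eis_theta_def)


section \<open>The Golay code and Parker's loop\<close>

text \<open>
  A word is identified with its support, so addition of words is symmetric difference.
  The extended binary Golay code is, up to a permutation of the coordinates, the unique doubly
  even linear code of length \<open>24\<close>, dimension \<open>12\<close> and minimum weight \<open>8\<close>.
\<close>

definition golay_code :: "'i::finite set set \<Rightarrow> bool" where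
  "golay_code C \<longleftrightarrow>
     CARD('i) = 24 \<and>
     {} \<in> C \<and> (\<forall>c\<in>C. \<forall>d\<in>C. sym_diff c d \<in> C) \<and> card C = 2 ^ 12 \<and>
     (\<forall>c\<in>C. 4 dvd card c) \<and>
     (\<forall>c\<in>C. c \<noteq> {} \<longrightarrow> 8 \<le> card c)"

record ('i, 'p) loop_data =
  lmult :: "'p \<Rightarrow> 'p \<Rightarrow> 'p" (infixl "\<cdot>\<index>" 70)
  lone :: 'p
  lminus_one :: 'p
  lbar :: "'p \<Rightarrow> 'i set"
  lOmega :: 'p

definition lneg :: "('i, 'p) loop_data \<Rightarrow> 'p \<Rightarrow> 'p" where
  "lneg P d = lminus_one P \<cdot>\<^bsub>P\<^esub> d"

text \<open>\<open>lsign P n d\<close> is \<open>(-1)\<close> to the power \<open>n\<close>, times \<open>d\<close>.\<close>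

definition lsign :: "('i, 'p) loop_data \<Rightarrow> nat \<Rightarrow> 'p \<Rightarrow> 'p" where
  "lsign P n d = (if even n then d else lneg P d)"

locale loop_with_one =
  fixes P :: "('i, 'p) loop_data" (structure)
  assumes one_left [simp]: "lone P \<cdot> d = d"
    and one_right [simp]: "d \<cdot> lone P = d"
    and left_quotient: "\<exists>!x. d \<cdot> x = e"
    and right_quotient: "\<exists>!x. x \<cdot> d = e"

locale moufang_loop = loop_with_one +
  assumes moufang: "d \<cdot> (e \<cdot> (d \<cdot> f)) = ((d \<cdot> e) \<cdot> d) \<cdot> f"

locale parker_loop = moufang_loop P
  for C :: "'i::finite set set" and P :: "('i, 'p) loop_data" (structure) +
  assumes minus_one_commute: "lminus_one P \<cdot> d = d \<cdot> lminus_one P"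
    and minus_one_assoc1: "(lminus_one P \<cdot> d) \<cdot> e = lminus_one P \<cdot> (d \<cdot> e)"
    and minus_one_assoc2: "(d \<cdot> lminus_one P) \<cdot> e = d \<cdot> (lminus_one P \<cdot> e)"
    and minus_one_assoc3: "(d \<cdot> e) \<cdot> lminus_one P = d \<cdot> (e \<cdot> lminus_one P)"
    and minus_one_order: "lminus_one P \<noteq> lone P" "lminus_one P \<cdot> lminus_one P = lone P"
    and bar_mult: "lbar P (d \<cdot> e) = sym_diff (lbar P d) (lbar P e)"
    and bar_surj: "range (lbar P) = C"
    and bar_kernel: "lbar P d = {} \<longleftrightarrow> d = lone P \<or> d = lminus_one P"
    and square: "d \<cdot> d = lsign P (card (lbar P d) div 4) (lone P)"
    and commutator: "d \<cdot> e = lsign P (card (lbar P d \<inter> lbar P e) div 2) (e \<cdot> d)"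
    and associator: "(d \<cdot> e) \<cdot> f = lsign P (card (lbar P d \<inter> lbar P e \<inter> lbar P f)) (d \<cdot> (e \<cdot> f))"
    and bar_Omega: "lbar P (lOmega P) = UNIV"


section \<open>The algebra\<close>

text \<open>
  The space spanned by symbols \<open>x d\<close> (\<open>d\<close> over an octad) subject only to \<open>x (-d) = - x d\<close>
  is modelled by the odd functions supported on the lifts of octads; \<open>x d\<close> is the function with
  value \<open>1\<close> at \<open>d\<close> and \<open>-1\<close> at \<open>-d\<close>.
\<close>

type_synonym ('i, 'p) vec = "('i \<Rightarrow> eis) \<times> ('p \<Rightarrow> eis)"

definition octad_lifts :: "('i, 'p) loop_data \<Rightarrow> 'p set" where
  "octad_lifts P = {d. card (lbar P d) = 8}"

definition alg :: "('i, 'p) loop_data \<Rightarrow> ('i, 'p) vec set" where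
  "alg P = {(a, w). (\<forall>d. w (lneg P d) = - w d) \<and> (\<forall>d. d \<notin> octad_lifts P \<longrightarrow> w d = 0)}"

definition scal :: "eis \<Rightarrow> ('i, 'p) vec \<Rightarrow> ('i, 'p) vec" (infixr "*\<^sub>E" 75) where
  "c *\<^sub>E v = (\<lambda>i. c * fst v i, \<lambda>d. c * snd v d)"

definition uvec :: "'i \<Rightarrow> ('i, 'p) vec" where
  "uvec i = (\<lambda>j. if j = i then 1 else 0, \<lambda>d. 0)"

definition xvec :: "('i, 'p) loop_data \<Rightarrow> 'p \<Rightarrow> ('i, 'p) vec" where
  "xvec P d = (\<lambda>i. 0, \<lambda>e. if e = d then 1 else if e = lneg P d then - 1 else 0)"

definition uu_table :: "'i::finite \<Rightarrow> 'i \<Rightarrow> ('i, 'p) vec" where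
  "uu_table i j = (1 / 128) *\<^sub>E
     (if i = j then (- 81) *\<^sub>E uvec i + 15 *\<^sub>E (\<Sum>k\<in>UNIV - {i}. uvec k)
      else 15 *\<^sub>E uvec i + 15 *\<^sub>E uvec j - (\<Sum>k\<in>UNIV - {i, j}. uvec k))"

definition ux_table :: "('i, 'p) loop_data \<Rightarrow> 'i \<Rightarrow> 'p \<Rightarrow> ('i, 'p) vec" where
  "ux_table P i d = (1 / 16) *\<^sub>E (if i \<in> lbar P d then 3 *\<^sub>E xvec P d else - xvec P d)"

text \<open>The value at \<open>f = -d\<close> is forced by \<open>x (-d) = - x d\<close>.\<close>

definition xx_table :: "('i::finite, 'p) loop_data \<Rightarrow> 'p \<Rightarrow> 'p \<Rightarrow> ('i, 'p) vec" where
  "xx_table P d f = (1 / 2) *\<^sub>E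
     (if f = d then 3 *\<^sub>E (\<Sum>i\<in>lbar P d. uvec i) - (\<Sum>i\<in>UNIV - lbar P d. uvec i)
      else if f = lneg P d then - (3 *\<^sub>E (\<Sum>i\<in>lbar P d. uvec i) - (\<Sum>i\<in>UNIV - lbar P d. uvec i))
      else if card (lbar P d \<inter> lbar P f) = 4 then xvec P (d \<cdot>\<^bsub>P\<^esub> f)
      else if lbar P d \<inter> lbar P f = {} then eis_theta *\<^sub>E xvec P ((d \<cdot>\<^bsub>P\<^esub> f) \<cdot>\<^bsub>P\<^esub> lOmega P)
      else 0)"

text \<open>
  The conjugate-bilinear extension of the tables. Each octad has two lifts, and
  \<open>w = (1 / 2) * (\<Sum>d. w d * x d)\<close>, which explains the factors \<open>1 / 2\<close> and \<open>1 / 4\<close>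
  here and in \<open>act\<close> below.
\<close>

definition prd :: "('i::finite, 'p) loop_data \<Rightarrow> ('i, 'p) vec \<Rightarrow> ('i, 'p) vec \<Rightarrow> ('i, 'p) vec" where
  "prd P v v' =
     (\<Sum>i\<in>UNIV. \<Sum>j\<in>UNIV. (eis_cnj (fst v i) * eis_cnj (fst v' j)) *\<^sub>E uu_table i j)
   + (\<Sum>i\<in>UNIV. \<Sum>d\<in>octad_lifts P.
        (1 / 2 * (eis_cnj (fst v i) * eis_cnj (snd v' d) + eis_cnj (snd v d) * eis_cnj (fst v' i)))
          *\<^sub>E ux_table P i d)
   + (\<Sum>d\<in>octad_lifts P. \<Sum>f\<in>octad_lifts P.
        (1 / 4 * (eis_cnj (snd v d) * eis_cnj (snd v' f))) *\<^sub>E xx_table P d f)"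

definition semilinear_on :: "(eis \<Rightarrow> eis) \<Rightarrow> ('i, 'p) vec set \<Rightarrow> (('i, 'p) vec \<Rightarrow> ('i, 'p) vec) \<Rightarrow> bool"
  where "semilinear_on \<sigma> S g \<longleftrightarrow>
    (\<forall>v\<in>S. \<forall>w\<in>S. g (v + w) = g v + g w) \<and> (\<forall>c. \<forall>v\<in>S. g (c *\<^sub>E v) = \<sigma> c *\<^sub>E g v)"

abbreviation "linear_on_alg P g \<equiv> semilinear_on (\<lambda>c. c) (alg P) g"
abbreviation "conj_linear_on_alg P g \<equiv> semilinear_on eis_cnj (alg P) g"

definition Aut_sl :: "('i::finite, 'p) loop_data \<Rightarrow> (('i, 'p) vec \<Rightarrow> ('i, 'p) vec) monoid" where
  "Aut_sl P = BijGroup (alg P) \<lparr>carrier := {g \<in> Bij (alg P).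
     (linear_on_alg P g \<or> conj_linear_on_alg P g) \<and>
     (\<forall>v\<in>alg P. \<forall>w\<in>alg P. g (prd P v w) = prd P (g v) (g w))}\<rparr>"


section \<open>The base group\<close>

text \<open>
  Permutations of coordinates and automorphisms of the loop act on the right, so the
  product of \<open>h\<close> and \<open>k\<close> in the following groups is \<open>h\<close> followed by \<open>k\<close>.
\<close>

definition M24 :: "'i set set \<Rightarrow> ('i \<Rightarrow> 'i) monoid" where
  "M24 C = \<lparr>carrier = {p. bij p \<and> (image p) ` C = C}, mult = (\<lambda>p q. q \<circ> p), one = id\<rparr>"

definition Aut_St :: "'i set set \<Rightarrow> ('i, 'p) loop_data \<Rightarrow> ('p \<Rightarrow> 'p) monoid" where
  "Aut_St C P = \<lparr>carrier = {h. bij h \<and> (\<forall>d e. h (d \<cdot>\<^bsub>P\<^esub> e) = h d \<cdot>\<^bsub>P\<^esub> h e) \<and>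
       (\<exists>p\<in>carrier (M24 C). \<forall>d. lbar P (h d) = p ` lbar P d)},
     mult = (\<lambda>h k. k \<circ> h), one = id\<rparr>"

definition induced_perm :: "'i set set \<Rightarrow> ('i, 'p) loop_data \<Rightarrow> ('p \<Rightarrow> 'p) \<Rightarrow> 'i \<Rightarrow> 'i" where
  "induced_perm C P h = (THE p. p \<in> carrier (M24 C) \<and> (\<forall>d. lbar P (h d) = p ` lbar P d))"

definition eps :: "('i, 'p) loop_data \<Rightarrow> ('p \<Rightarrow> 'p) \<Rightarrow> bit" where
  "eps P h = (if h (lOmega P) = lOmega P then 0 else 1)"

definition Aut_St_plus :: "'i set set \<Rightarrow> ('i, 'p) loop_data \<Rightarrow> ('p \<Rightarrow> 'p) monoid" where
  "Aut_St_plus C P = (Aut_St C P)\<lparr>carrier := {h \<in> carrier (Aut_St C P). eps P h = 0}\<rparr>"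

definition eps_conj :: "bit \<Rightarrow> eis \<Rightarrow> eis" where
  "eps_conj e c = (if e = 0 then c else eis_cnj c)"

definition act :: "'i::finite set set \<Rightarrow> ('i, 'p) loop_data \<Rightarrow> ('p \<Rightarrow> 'p) \<Rightarrow> ('i, 'p) vec \<Rightarrow> ('i, 'p) vec"
  where "act C P h v =
     (\<Sum>i\<in>UNIV. eps_conj (eps P h) (fst v i) *\<^sub>E uvec (induced_perm C P h i))
   + (\<Sum>d\<in>octad_lifts P. (1 / 2 * eps_conj (eps P h) (snd v d)) *\<^sub>E xvec P (h d))"

definition cocode :: "'i set set \<Rightarrow> 'i set set monoid" where
  "cocode C = \<lparr>carrier = UNIV, mult = sym_diff, one = {}\<rparr> Mod C"

text \<open>In ATLAS notation such a group is written \<open>2^n\<close>.\<close>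

definition elementary_abelian_2_group :: "nat \<Rightarrow> ('a, 'b) monoid_scheme \<Rightarrow> bool" where
  "elementary_abelian_2_group n G \<longleftrightarrow>
     comm_group G \<and> (\<forall>g\<in>carrier G. g \<otimes>\<^bsub>G\<^esub> g = \<one>\<^bsub>G\<^esub>) \<and> order G = 2 ^ n"

section \<open>The definitions have the intended values\<close>

lemma sum_apply: "sum f S x = (\<Sum>s\<in>S. f s x)"
  by (induction S rule: infinite_finite_induct) simp_all

lemma vec_eqI: "(\<And>i. fst v i = fst w i) \<Longrightarrow> (\<And>d. snd v d = snd w d) \<Longrightarrow> v = w"
  by (auto simp: prod_eq_iff)

lemma fst_scal [simp]: "fst (c *\<^sub>E v) i = c * fst v i"
  and snd_scal [simp]: "snd (c *\<^sub>E v) d = c * snd v d"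
  by (simp_all add: scal_def)

lemma fst_uvec [simp]: "fst (uvec i) j = (if j = i then 1 else 0)"
  and snd_uvec [simp]: "snd (uvec i) d = 0"
  and fst_xvec [simp]: "fst (xvec P d) i = 0"
  and snd_xvec: "snd (xvec P d) e = (if e = d then 1 else if e = lneg P d then - 1 else 0)"
  by (simp_all add: uvec_def xvec_def)

lemma scal_zero_left [simp]: "0 *\<^sub>E v = 0"
  and scal_zero_right [simp]: "c *\<^sub>E 0 = 0"
  and scal_one [simp]: "1 *\<^sub>E v = v"
  and scal_scal [simp]: "b *\<^sub>E c *\<^sub>E v = (b * c) *\<^sub>E v"
  and scal_minus_right [simp]: "c *\<^sub>E (- v) = - (c *\<^sub>E v)"
  and scal_minus_left [simp]: "(- c) *\<^sub>E v = - (c *\<^sub>E v)"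
  and scal_add_right: "c *\<^sub>E (v + w) = c *\<^sub>E v + c *\<^sub>E w"
  and scal_diff_right: "c *\<^sub>E (v - w) = c *\<^sub>E v - c *\<^sub>E w"
  and scal_add_left: "(b + c) *\<^sub>E v = b *\<^sub>E v + c *\<^sub>E v"
  by (rule vec_eqI; simp add: algebra_simps)+

lemma scal_sum_right: "c *\<^sub>E sum f S = (\<Sum>s\<in>S. c *\<^sub>E f s)"
  by (induction S rule: infinite_finite_induct) (simp_all add: scal_add_right)

lemma eps_conj_simps [simp]:
  "eps_conj e 0 = 0" "eps_conj e 1 = 1" "eps_conj e (x + y) = eps_conj e x + eps_conj e y"
  "eps_conj e (- x) = - eps_conj e x" "eps_conj e (x * y) = eps_conj e x * eps_conj e y"
  by (simp_all add: eps_conj_def)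

context parker_loop
begin

lemma neg_neq: "lneg P d \<noteq> d"
  unfolding lneg_def using right_quotient[of d d] one_left[of d] minus_one_order(1) by metis

lemma neg_neg: "lneg P (lneg P d) = d"
  unfolding lneg_def using minus_one_assoc1[of "lminus_one P" d] minus_one_order(2) by simp

lemma neg_mult_left: "lneg P d \<cdot> e = lneg P (d \<cdot> e)"
  unfolding lneg_def by (rule minus_one_assoc1)

lemma neg_mult_right: "d \<cdot> lneg P e = lneg P (d \<cdot> e)"
  unfolding lneg_def by (metis minus_one_assoc1 minus_one_assoc2 minus_one_commute)

lemma bar_neg: "lbar P (lneg P d) = lbar P d"
  unfolding lneg_def using bar_mult[of "lminus_one P" d] bar_kernel[of "lminus_one P"] by simp

lemma octad_lifts_neg: "lneg P d \<in> octad_lifts P \<longleftrightarrow> d \<in> octad_lifts P"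
  by (simp add: octad_lifts_def bar_neg)

lemma bar_eq_iff: "lbar P d = lbar P e \<longleftrightarrow> d = e \<or> d = lneg P e"
proof
  assume eq: "lbar P d = lbar P e"
  obtain z where z: "z \<cdot> e = d" using right_quotient[of e d] by blast
  have "sym_diff (lbar P z) (lbar P e) = lbar P e" using bar_mult[of z e] z eq by simp
  then have "lbar P z = {}" by blast
  then show "d = e \<or> d = lneg P e" using z bar_kernel[of z] by (auto simp: lneg_def)
qed (auto simp: bar_neg)

lemma finite_lifts: "finite (S :: 'p set)"
proof -
  have "finite (lbar P -` {c})" for c
  proof (cases "\<exists>d. lbar P d = c")
    case True
    then obtain d where "lbar P d = c" by blast
    then have "lbar P -` {c} \<subseteq> {d, lneg P d}" using bar_eq_iff[of _ d] by auto
    then show ?thesis by (rule finite_subset) simp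
  next
    case False
    then have "lbar P -` {c} = {}" by auto
    then show ?thesis by simp
  qed
  then have "finite (\<Union>c\<in>UNIV. lbar P -` {c})" by (intro finite_UN_I) simp_all
  then show ?thesis by (rule rev_finite_subset) auto
qed

lemma xvec_neg: "xvec P (lneg P d) = - xvec P d"
  using neg_neq[of d] by (intro vec_eqI) (auto simp: snd_xvec neg_neg)

lemma sum_xvec:
  assumes "d \<in> octad_lifts P" and "F (lneg P d) = - F d"
  shows "(\<Sum>e\<in>octad_lifts P. (1 / 2 * snd (xvec P d) e) *\<^sub>E F e) = F d"
proof -
  have "(\<Sum>e\<in>octad_lifts P. (1 / 2 * snd (xvec P d) e) *\<^sub>E F e)
      = (\<Sum>e\<in>{d, lneg P d}. (1 / 2 * snd (xvec P d) e) *\<^sub>E F e)"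
    using assms(1) octad_lifts_neg
    by (intro sum.mono_neutral_right) (auto simp: finite_lifts snd_xvec)
  also have "\<dots> = (1 / 2) *\<^sub>E F d + (1 / 2) *\<^sub>E F d"
    using neg_neq[of d] assms(2) by (auto simp: snd_xvec)
  also have "\<dots> = F d" by (simp flip: scal_add_left)
  finally show ?thesis .
qed

lemma sum_uvec: "(\<Sum>i\<in>UNIV. (if i = j then 1 else 0) *\<^sub>E F i) = F (j :: 'i)"
proof -
  have "(\<Sum>i\<in>UNIV. (if i = j then 1 else 0) *\<^sub>E F i) = (\<Sum>i\<in>{j}. F i)"
    by (rule sum.mono_neutral_cong_right) auto
  then show ?thesis by simp
qed

lemma alg_expand:
  assumes "v \<in> alg P"
  shows "v = (\<Sum>i\<in>UNIV. fst v i *\<^sub>E uvec i) + (\<Sum>d\<in>octad_lifts P. (1 / 2 * snd v d) *\<^sub>E xvec P d)"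
proof (rule vec_eqI)
  fix i
  have "(\<Sum>j\<in>UNIV. fst v j * (if i = j then 1 else 0)) = fst v i"
    by (simp add: sum.delta if_distrib cong: if_cong)
  then show "fst v i = fst ((\<Sum>i\<in>UNIV. fst v i *\<^sub>E uvec i)
    + (\<Sum>d\<in>octad_lifts P. (1 / 2 * snd v d) *\<^sub>E xvec P d)) i"
    by (simp add: fst_sum sum_apply)
next
  fix d
  have neg: "snd v (lneg P e) = - snd v e" for e
    using assms by (auto simp: alg_def split: prod.splits)
  have "(\<Sum>e\<in>octad_lifts P. 1 / 2 * snd v e * snd (xvec P e) d)
      = snd v d"
  proof (cases "d \<in> octad_lifts P")
    case True
    have "(\<Sum>e\<in>octad_lifts P. 1 / 2 * snd v e * snd (xvec P e) d)
      = (\<Sum>e\<in>{d, lneg P d}. 1 / 2 * snd v e * snd (xvec P e) d)"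
      using True octad_lifts_neg neg_neg
      by (intro sum.mono_neutral_right) (auto simp: finite_lifts snd_xvec)
    also have "\<dots> = snd v d"
      using neg_neq[of d] by (auto simp: snd_xvec neg_neg neg)
    finally show ?thesis .
  next
    case False
    then have "snd v d = 0" using assms by (auto simp: alg_def split: prod.splits)
    moreover have "snd (xvec P e) d = 0" if "e \<in> octad_lifts P" for e
      using that False octad_lifts_neg by (auto simp: snd_xvec)
    ultimately show ?thesis by simp
  qed
  then show "snd v d = snd ((\<Sum>i\<in>UNIV. fst v i *\<^sub>E uvec i)
    + (\<Sum>d\<in>octad_lifts P. (1 / 2 * snd v d) *\<^sub>E xvec P d)) d"
    by (simp add: snd_sum sum_apply)
qed

lemma uvec_in_alg: "uvec i \<in> alg P"
  by (simp add: alg_def uvec_def)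

lemma xvec_in_alg: "d \<in> octad_lifts P \<Longrightarrow> xvec P d \<in> alg P"
  using neg_neq octad_lifts_neg by (auto simp: alg_def xvec_def) (metis neg_neg)+

lemma ux_table_neg: "ux_table P i (lneg P d) = - ux_table P i d"
  by (simp add: ux_table_def bar_neg xvec_neg)

lemma xx_table_neg_right: "xx_table P d (lneg P f) = - xx_table P d f"
proof -
  have "lneg P f = d \<longleftrightarrow> f = lneg P d" "lneg P f = lneg P d \<longleftrightarrow> f = d" "lneg P d \<noteq> d"
    using neg_neg neg_neq by metis+
  then show ?thesis
    by (auto simp: xx_table_def bar_neg neg_mult_left neg_mult_right xvec_neg scal_diff_right)
qed

lemma xx_table_neg_left: "xx_table P (lneg P d) f = - xx_table P d f"
proof -
  have "f = lneg P (lneg P d) \<longleftrightarrow> f = d" "lneg P d \<noteq> d"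
    using neg_neg neg_neq by metis+
  then show ?thesis
    by (auto simp: xx_table_def bar_neg neg_mult_left neg_mult_right xvec_neg scal_diff_right)
qed

lemma eis_cnj_delta: "eis_cnj (if b then 1 else 0) = (if b then 1 else 0)"
  and eps_conj_delta: "eps_conj s (if b then 1 else 0) = (if b then 1 else 0)"
  and eis_cnj_xvec: "eis_cnj (snd (xvec P d) e) = snd (xvec P d) e"
  by (simp_all add: snd_xvec)

lemma prd_uu: "prd P (uvec i) (uvec j) = uu_table i j"
proof -
  have "prd P (uvec i) (uvec j)
    = (\<Sum>k\<in>UNIV. (if k = i then 1 else 0) *\<^sub>E (\<Sum>l\<in>UNIV. (if l = j then 1 else 0) *\<^sub>E uu_table k l))"
    by (simp add: prd_def scal_sum_right eis_cnj_delta )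
  then show ?thesis by (simp only: sum_uvec)
qed

lemma prd_ux:
  assumes "d \<in> octad_lifts P"
  shows "prd P (uvec i) (xvec P d) = ux_table P i d"
proof -
  have "prd P (uvec i) (xvec P d)
    = (\<Sum>k\<in>UNIV. (if k = i then 1 else 0) *\<^sub>E
        (\<Sum>e\<in>octad_lifts P. (1 / 2 * snd (xvec P d) e) *\<^sub>E ux_table P k e))"
    by (simp add: prd_def scal_sum_right eis_cnj_delta eis_cnj_xvec ac_simps )
  then show ?thesis using assms by (simp only: sum_uvec sum_xvec ux_table_neg)
qed

lemma prd_xx:
  assumes "d \<in> octad_lifts P" "f \<in> octad_lifts P"
  shows "prd P (xvec P d) (xvec P f) = xx_table P d f"
proof -
  have "prd P (xvec P d) (xvec P f)
    = (\<Sum>e\<in>octad_lifts P. (1 / 2 * snd (xvec P d) e) *\<^sub>E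
        (\<Sum>g\<in>octad_lifts P. (1 / 2 * snd (xvec P f) g) *\<^sub>E xx_table P e g))"
    by (simp add: prd_def scal_sum_right eis_cnj_xvec ac_simps)
  then show ?thesis using assms by (simp only: sum_xvec xx_table_neg_left xx_table_neg_right)
qed

lemma uu_table_commute: "uu_table i j = uu_table j i"
  by (auto simp: uu_table_def add.commute insert_commute)

lemma xx_table_commute: "xx_table P d f = xx_table P f d"
proof -
  have 1: "f = lneg P d \<longleftrightarrow> d = lneg P f" using neg_neg by metis
  have 2: "d \<cdot> f = f \<cdot> d" if "card (lbar P d \<inter> lbar P f) = 4"
    using commutator[of d f] that by (simp add: lsign_def)
  have 3: "d \<cdot> f = f \<cdot> d" if "lbar P d \<inter> lbar P f = {}"
    using commutator[of d f] that by (simp add: lsign_def)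
  show ?thesis
    by (cases "f = d"; cases "f = lneg P d")
      (auto simp: xx_table_def 1 2 3 Int_commute bar_neg neg_neg)
qed

lemma prd_commute: "prd P v w = prd P w v"
proof -
  have "(\<Sum>i\<in>UNIV. \<Sum>j\<in>UNIV. (eis_cnj (fst v i) * eis_cnj (fst w j)) *\<^sub>E uu_table i j)
      = (\<Sum>i\<in>UNIV. \<Sum>j\<in>UNIV. (eis_cnj (fst w i) * eis_cnj (fst v j)) *\<^sub>E uu_table i j)"
    by (subst sum.swap) (simp add: mult.commute uu_table_commute)
  moreover have "(\<Sum>d\<in>octad_lifts P. \<Sum>f\<in>octad_lifts P.
        (1 / 4 * (eis_cnj (snd v d) * eis_cnj (snd w f))) *\<^sub>E xx_table P d f)
      = (\<Sum>d\<in>octad_lifts P. \<Sum>f\<in>octad_lifts P.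
        (1 / 4 * (eis_cnj (snd w d) * eis_cnj (snd v f))) *\<^sub>E xx_table P d f)"
    by (subst sum.swap) (simp add: mult.commute xx_table_commute)
  ultimately show ?thesis unfolding prd_def by (simp add: ac_simps)
qed

lemma prd_conj_linear:
  "prd P (a *\<^sub>E v + b *\<^sub>E w) z = eis_cnj a *\<^sub>E prd P v z + eis_cnj b *\<^sub>E prd P w z"
  by (simp add: prd_def scal_sum_right scal_add_right sum.distrib scal_add_left add_divide_distrib
      algebra_simps)

lemma alg_minus: "v \<in> alg P \<Longrightarrow> - v \<in> alg P"
  and alg_add: "v \<in> alg P \<Longrightarrow> w \<in> alg P \<Longrightarrow> v + w \<in> alg P"
  and alg_scal: "v \<in> alg P \<Longrightarrow> c *\<^sub>E v \<in> alg P"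
  and alg_zero: "0 \<in> alg P"
  by (auto simp: alg_def scal_def zero_prod_def)

lemma alg_diff: "v \<in> alg P \<Longrightarrow> w \<in> alg P \<Longrightarrow> v - w \<in> alg P"
  using alg_add[of v "- w"] alg_minus[of w] by simp

lemma alg_sum: "(\<And>s. s \<in> S \<Longrightarrow> f s \<in> alg P) \<Longrightarrow> sum f S \<in> alg P"
  by (induction S rule: infinite_finite_induct) (auto intro: alg_zero alg_add)

lemma octad_lifts_mult:
  assumes "CARD('i) = 24" "d \<in> octad_lifts P" "f \<in> octad_lifts P"
  shows "card (lbar P d \<inter> lbar P f) = 4 \<Longrightarrow> d \<cdot> f \<in> octad_lifts P"
    and "lbar P d \<inter> lbar P f = {} \<Longrightarrow> (d \<cdot> f) \<cdot> lOmega P \<in> octad_lifts P"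
proof -
  have c: "card (lbar P d) = 8" "card (lbar P f) = 8"
    using assms by (simp_all add: octad_lifts_def)
  show "d \<cdot> f \<in> octad_lifts P" if "card (lbar P d \<inter> lbar P f) = 4"
  proof -
    have "card (lbar P d - lbar P f) = 4" "card (lbar P f - lbar P d) = 4"
      using that c by (simp_all add: card_Diff_subset_Int Int_commute)
    then have "card ((lbar P d - lbar P f) \<union> (lbar P f - lbar P d)) = 8"
      by (subst card_Un_disjoint) auto
    then show ?thesis by (simp add: octad_lifts_def bar_mult)
  qed
  show "(d \<cdot> f) \<cdot> lOmega P \<in> octad_lifts P" if "lbar P d \<inter> lbar P f = {}"
  proof -
    have "lbar P ((d \<cdot> f) \<cdot> lOmega P) = UNIV - (lbar P d \<union> lbar P f)"
      using that by (auto simp: bar_mult bar_Omega)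
    moreover have "card (lbar P d \<union> lbar P f) = 16"
      using that c by (simp add: card_Un_disjoint)
    ultimately show ?thesis using assms(1) by (simp add: octad_lifts_def card_Diff_subset)
  qed
qed

lemma prd_in_alg:
  assumes "CARD('i) = 24"
  shows "prd P v w \<in> alg P"
proof -
  have "uu_table i j \<in> alg P" for i j
    by (auto simp: uu_table_def intro!: alg_add alg_diff alg_scal alg_minus alg_sum uvec_in_alg)
  moreover have "ux_table P i d \<in> alg P" if "d \<in> octad_lifts P" for i d
    using that by (auto simp: ux_table_def intro!: alg_scal alg_minus xvec_in_alg)
  moreover have "xx_table P d f \<in> alg P" if "d \<in> octad_lifts P" "f \<in> octad_lifts P" for d f
    using octad_lifts_mult[OF assms that]
    by (auto simp: xx_table_def
        intro!: alg_diff alg_scal alg_minus alg_zero alg_sum uvec_in_alg xvec_in_alg)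
  ultimately show ?thesis
    unfolding prd_def by (auto intro!: alg_add alg_scal alg_sum)
qed

lemma Aut_St_neg:
  assumes "h \<in> carrier (Aut_St C P)"
  shows "h (lneg P d) = lneg P (h d)"
proof -
  from assms obtain p where h: "bij h" "\<And>d e. h (d \<cdot> e) = h d \<cdot> h e"
    and p: "\<And>d. lbar P (h d) = p ` lbar P d"
    by (auto simp: Aut_St_def)
  have "lbar P (h (lminus_one P)) = {}" using p[of "lminus_one P"] bar_kernel by simp
  moreover have "h (lone P) = lone P"
    using h(2)[of "lone P" "lone P"] right_quotient[of "h (lone P)" "h (lone P)"] one_left
    by metis
  then have "h (lminus_one P) \<noteq> lone P"
    using h(1) minus_one_order(1) by (metis bij_is_inj injD)
  ultimately have "h (lminus_one P) = lminus_one P" using bar_kernel by blast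
  then show ?thesis by (simp add: lneg_def h(2))
qed

lemma Aut_St_Omega:
  assumes "h \<in> carrier (Aut_St C P)"
  shows "h (lOmega P) = (if eps P h = 0 then lOmega P else lneg P (lOmega P))"
proof -
  from assms obtain p where "bij p" and p: "\<And>d. lbar P (h d) = p ` lbar P d"
    by (auto simp: Aut_St_def M24_def)
  then have "lbar P (h (lOmega P)) = lbar P (lOmega P)"
    using bar_Omega by (simp add: bij_def)
  then show ?thesis by (auto simp: eps_def bar_eq_iff)
qed

lemma act_uvec: "act C P h (uvec i) = uvec (induced_perm C P h i)"
proof -
  have "act C P h (uvec i) = (\<Sum>k\<in>UNIV. (if k = i then 1 else 0) *\<^sub>E uvec (induced_perm C P h k))"
    by (simp add: act_def eps_conj_delta)
  then show ?thesis by (simp only: sum_uvec)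
qed

lemma act_xvec:
  assumes "h \<in> carrier (Aut_St C P)" "d \<in> octad_lifts P"
  shows "act C P h (xvec P d) = xvec P (h d)"
proof -
  have "eps_conj e (snd (xvec P d) f) = snd (xvec P d) f" for e f by (simp add: snd_xvec)
  then have "act C P h (xvec P d)
      = (\<Sum>f\<in>octad_lifts P. (1 / 2 * snd (xvec P d) f) *\<^sub>E xvec P (h f))"
    by (simp add: act_def)
  then show ?thesis
    using assms by (simp only: sum_xvec Aut_St_neg xvec_neg)
qed

lemma act_add: "act C P h (v + w) = act C P h v + act C P h w"
  by (simp add: act_def sum.distrib scal_add_left algebra_simps)

lemma act_scal: "act C P h (c *\<^sub>E v) = eps_conj (eps P h) c *\<^sub>E act C P h v"
  by (simp add: act_def scal_add_right scal_sum_right algebra_simps)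

end

end

theory Submission
  imports Defs
begin

text \<open>
  Three facts about the Golay code \<open>C\<close> carry the group-theoretic part. All come from the character
  sum \<open>card_sets_with_parity\<close>: the code is its own dual, every linear functional on it sends \<open>c\<close>
  to the parity of \<open>card (S \<inter> c)\<close> for some set \<open>S\<close>, and hence codewords separate points, so that a standard
  automorphism of the loop determines its coordinate permutation.

  An automorphism inducing the identity permutation changes each \<open>d\<close> by a sign depending linearly on
  its word. So it is \<open>d \<mapsto> (-1) ^ card (S \<inter> lbar P d) d\<close> for some \<open>S\<close>, unique modulo \<open>C\<close>: the kernel is
  the cocode, of order \<open>2 ^ 12\<close> (\<open>kernel_induced_perm\<close>, \<open>cocode_iso\<close>). Such a map negates \<open>\<Omega>\<close>
  iff \<open>S\<close> is odd. Since odd sets exist, the automorphisms fixing \<open>\<Omega>\<close> have index two in the kernel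
  and in the whole group, and still cover \<open>M24\<close>.

  Every code automorphism \<open>p\<close> lifts to the loop (\<open>lift_perm\<close>) because square, commutator and
  associator of the loop depend only on cardinalities of intersections of words, which \<open>p\<close>
  preserves. Comparing the loop with its pullback along \<open>p\<close> therefore gives an extension of \<open>C\<close> by
  \<open>\<plusminus>1\<close> that is an elementary abelian 2-group; it splits, and a complement is the graph of a lift.

  The product of the algebra is written in terms of the loop, of incidence between points and words,
  and of \<open>\<vartheta> \<Omega>\<close>, so an automorphism fixing \<open>\<Omega>\<close> preserves it. One that negates \<open>\<Omega>\<close> preserves it
  when scalars are conjugated, because \<open>\<vartheta>\<close> changes sign as well (\<open>act_xx_table\<close>).

  The action is faithful since it determines an automorphism on the lifts of octads
  (\<open>Aut_St_eqI\<close>), and octads generate the code. The latter rests on the sphere-packing equality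
  \<open>24 + 2024 = 2 ^ 11\<close>: every odd set differs from a codeword in one or three points, so any five
  points lie in an octad, and adding to a nonempty codeword an octad through five of its points makes
  it shorter.
\<close>


section \<open>Binary codes and parity functionals\<close>

lemma card_sym_diff:
  assumes "finite A" "finite B"
  shows "card (sym_diff A B) + 2 * card (A \<inter> B) = card A + card B"
proof -
  have "card (sym_diff A B) = card (A - B) + card (B - A)"
    using assms by (intro card_Un_disjoint) auto
  then show ?thesis
    using card_Diff_subset_Int[of A B] card_Diff_subset_Int[of B A] assms
      card_mono[of A "A \<inter> B"] card_mono[of B "A \<inter> B"]
    by (simp add: Int_commute)
qed

lemma odd_card_sym_diff:
  assumes "finite A" "finite B"
  shows "odd (card (sym_diff A B)) \<longleftrightarrow> odd (card A) \<noteq> odd (card B)"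
  using card_sym_diff[OF assms] by presburger

lemma odd_card_Int_sym_diff:
  fixes S :: "'i::finite set"
  shows "odd (card (S \<inter> sym_diff c d)) \<longleftrightarrow> odd (card (S \<inter> c)) \<noteq> odd (card (S \<inter> d))"
    and "odd (card (sym_diff c d \<inter> S)) \<longleftrightarrow> odd (card (c \<inter> S)) \<noteq> odd (card (d \<inter> S))"
proof -
  have "S \<inter> sym_diff c d = sym_diff (S \<inter> c) (S \<inter> d)" "sym_diff c d \<inter> S = sym_diff (c \<inter> S) (d \<inter> S)"
    by blast+
  then show "odd (card (S \<inter> sym_diff c d)) \<longleftrightarrow> odd (card (S \<inter> c)) \<noteq> odd (card (S \<inter> d))"
    and "odd (card (sym_diff c d \<inter> S)) \<longleftrightarrow> odd (card (c \<inter> S)) \<noteq> odd (card (d \<inter> S))"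
    by (simp_all only: odd_card_sym_diff[OF finite finite])
qed

lemma sym_diff_cancel [simp]: "sym_diff (sym_diff A B) B = A"
  by blast

lemma sum_odd_involution_eq_0:
  fixes g :: "'a \<Rightarrow> int"
  assumes "\<And>x. x \<in> A \<Longrightarrow> t x \<in> A" "\<And>x. x \<in> A \<Longrightarrow> t (t x) = x" "\<And>x. x \<in> A \<Longrightarrow> g (t x) = - g x"
  shows "sum g A = 0"
proof -
  have "bij_betw t A A"
    by (rule bij_betw_byWitness[where f' = t]) (use assms in auto)
  then have "sum g A = (\<Sum>x\<in>A. g (t x))"
    by (simp add: sum.reindex_bij_betw)
  also have "\<dots> = - sum g A"
    using assms(3) by (simp add: sum_negf)
  finally show ?thesis by simp
qed

text \<open>
  This is orthogonality of characters. The sum of \<open>(- 1) ^ (f c + card (S \<inter> c))\<close> over all sets \<open>S\<close> and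
  all codewords \<open>c\<close> is evaluated in both orders: toggling a point of \<open>c\<close> in \<open>S\<close> shows that only
  \<open>c = {}\<close> contributes, while translating \<open>c\<close> by a codeword where \<open>f\<close> and the parity with \<open>S\<close>
  disagree shows that only those \<open>S\<close> contribute for which they agree throughout. The case \<open>f = 0\<close> is
  the dimension formula for the dual code; for general \<open>f\<close>, positivity of the right-hand side shows
  that every linear functional on \<open>C\<close> is a parity.
\<close>

lemma card_sets_with_parity:
  fixes C :: "'i::finite set set" and f :: "'i set \<Rightarrow> bool"
  assumes zero: "{} \<in> C" and closed: "\<And>c d. c \<in> C \<Longrightarrow> d \<in> C \<Longrightarrow> sym_diff c d \<in> C"
    and add: "\<And>c d. c \<in> C \<Longrightarrow> d \<in> C \<Longrightarrow> f (sym_diff c d) \<longleftrightarrow> f c \<noteq> f d"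
  shows "card {S. \<forall>c\<in>C. odd (card (S \<inter> c)) \<longleftrightarrow> f c} * card C = 2 ^ CARD('i)"
proof -
  define X where "X = {S. \<forall>c\<in>C. odd (card (S \<inter> c)) \<longleftrightarrow> f c}"
  define \<chi> :: "'i set \<Rightarrow> 'i set \<Rightarrow> int" where
    "\<chi> S c = (if odd (card (S \<inter> c)) \<longleftrightarrow> f c then 1 else - 1)" for S c
  have "\<not> f {}" using add[OF zero zero] by simp
  have by_columns: "(\<Sum>S\<in>UNIV. \<chi> S c) = (if c = {} then 2 ^ CARD('i) else 0)" for c
  proof (cases "c = {}")
    case True
    then show ?thesis
      using \<open>\<not> f {}\<close> card_Pow[of "UNIV :: 'i set"] by (simp add: \<chi>_def)
  next
    case False
    then obtain i where "i \<in> c" by blast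
    then have "\<chi> (sym_diff S {i}) c = - \<chi> S c" for S
      using odd_card_Int_sym_diff(2)[of S "{i}" c] by (simp add: \<chi>_def)
    then have "(\<Sum>S\<in>UNIV. \<chi> S c) = 0"
      by (intro sum_odd_involution_eq_0[where t = "\<lambda>S. sym_diff S {i}"]) auto
    then show ?thesis using False by simp
  qed
  have by_rows: "(\<Sum>c\<in>C. \<chi> S c) = (if S \<in> X then int (card C) else 0)" for S
  proof (cases "S \<in> X")
    case True
    then have "(\<Sum>c\<in>C. \<chi> S c) = (\<Sum>c\<in>C. 1)"
      by (intro sum.cong) (auto simp: X_def \<chi>_def)
    then show ?thesis using True by simp
  next
    case False
    then obtain e where e: "e \<in> C" "\<not> (odd (card (S \<inter> e)) \<longleftrightarrow> f e)"
      by (auto simp: X_def)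
    then have "\<chi> S (sym_diff c e) = - \<chi> S c" if "c \<in> C" for c
      using odd_card_Int_sym_diff(1)[of S c e] add[OF that e(1)] unfolding \<chi>_def by (smt (verit))
    then have "(\<Sum>c\<in>C. \<chi> S c) = 0"
      using closed e(1) by (intro sum_odd_involution_eq_0[where t = "\<lambda>c. sym_diff c e"]) auto
    then show ?thesis using False by simp
  qed
  have "int (card X * card C) = (\<Sum>S\<in>UNIV. \<Sum>c\<in>C. \<chi> S c)"
    by (simp add: by_rows sum.If_cases)
  also have "\<dots> = (\<Sum>c\<in>C. \<Sum>S\<in>UNIV. \<chi> S c)"
    by (rule sum.swap)
  also have "\<dots> = int (2 ^ CARD('i))"
    using zero by (simp add: by_columns)
  finally show ?thesis unfolding X_def by (simp only: of_nat_eq_iff)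
qed

lemma golay_codeD:
  fixes C :: "'i::finite set set"
  assumes "golay_code C"
  shows "CARD('i) = 24" "{} \<in> C" "c \<in> C \<Longrightarrow> d \<in> C \<Longrightarrow> sym_diff c d \<in> C" "card C = 2 ^ 12"
    "c \<in> C \<Longrightarrow> 4 dvd card c" "c \<in> C \<Longrightarrow> c \<noteq> {} \<Longrightarrow> 8 \<le> card c"
  using assms by (auto simp: golay_code_def)

lemma golay_even_Int:
  fixes C :: "'i::finite set set"
  assumes "golay_code C" "c \<in> C" "d \<in> C"
  shows "even (card (c \<inter> d))"
proof -
  have "4 dvd card (sym_diff c d)" "4 dvd card c" "4 dvd card d"
    using golay_codeD(3,5)[OF assms(1)] assms(2,3) by blast+
  then show ?thesis
    using card_sym_diff[of c d] by (simp add: dvd_def) presburger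
qed

text \<open>
  A doubly even code is contained in its dual, and here the dual has \<open>2 ^ 24 / 2 ^ 12\<close> elements, as
  many as \<open>C\<close>.
\<close>

lemma golay_self_dual:
  fixes C :: "'i::finite set set"
  assumes "golay_code C"
  shows "(\<forall>c\<in>C. even (card (S \<inter> c))) \<longleftrightarrow> S \<in> C"
proof -
  note g = golay_codeD[OF assms]
  let ?D = "{S. \<forall>c\<in>C. odd (card (S \<inter> c)) \<longleftrightarrow> False}"
  have "card ?D * card C = 2 ^ CARD('i)"
    by (rule card_sets_with_parity) (use g in auto)
  then have "card ?D = card C" using g(1,4) by simp
  moreover have "C \<subseteq> ?D" using golay_even_Int[OF assms] by auto
  ultimately have "C = ?D" by (intro card_subset_eq) auto
  then show ?thesis by auto
qed

lemma golay_functional_is_parity: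
  fixes C :: "'i::finite set set"
  assumes "golay_code C"
    and "\<And>c d. c \<in> C \<Longrightarrow> d \<in> C \<Longrightarrow> f (sym_diff c d) \<longleftrightarrow> f c \<noteq> f d"
  obtains S where "\<And>c. c \<in> C \<Longrightarrow> odd (card (S \<inter> c)) \<longleftrightarrow> f c"
proof -
  note g = golay_codeD[OF assms(1)]
  have "card {S. \<forall>c\<in>C. odd (card (S \<inter> c)) \<longleftrightarrow> f c} * card C = 2 ^ CARD('i)"
    by (rule card_sets_with_parity) (use g assms(2) in auto)
  then have "{S. \<forall>c\<in>C. odd (card (S \<inter> c)) \<longleftrightarrow> f c} \<noteq> {}" by (intro notI) simp
  then show thesis using that by blast
qed

text \<open>
  Two distinct points lying in the same codewords would form a word of weight two in the dual code,
  which is \<open>C\<close>.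
\<close>

lemma golay_separates_points:
  fixes C :: "'i::finite set set"
  assumes "golay_code C" and "\<And>c. c \<in> C \<Longrightarrow> i \<in> c \<longleftrightarrow> j \<in> c"
  shows "i = j"
proof (rule ccontr)
  assume "i \<noteq> j"
  have "even (card ({i, j} \<inter> c))" if "c \<in> C" for c
    using assms(2)[OF that] \<open>i \<noteq> j\<close> by (cases "i \<in> c") auto
  then have "{i, j} \<in> C" using golay_self_dual[OF assms(1)] by blast
  then show False using golay_codeD(6)[OF assms(1)] \<open>i \<noteq> j\<close> by fastforce
qed


section \<open>Octads generate the Golay code\<close>

lemma card_odd_sets:
  fixes i :: "'i::finite"
  shows "card {S :: 'i set. odd (card S)} * 2 = 2 ^ CARD('i)"
proof -
  let ?t = "\<lambda>S. sym_diff S {i}"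
  have "bij_betw ?t {S. odd (card S)} {S. even (card S)}"
  proof (rule bij_betw_byWitness[where f' = ?t])
    have "odd (card (?t S)) \<longleftrightarrow> even (card S)" for S
      using odd_card_sym_diff[of S "{i}"] by simp
    then show "?t ` {S. odd (card S)} \<subseteq> {S. even (card S)}" "?t ` {S. even (card S)} \<subseteq> {S. odd (card S)}"
      by blast+
  qed simp_all
  then have "card {S :: 'i set. odd (card S)} = card {S :: 'i set. even (card S)}"
    by (rule bij_betw_same_card)
  moreover have "card (UNIV :: 'i set set) = card {S :: 'i set. odd (card S)} + card {S :: 'i set. even (card S)}"
    by (subst card_Un_disjoint[symmetric]) (auto simp: Collect_disj_eq[symmetric] simp del: card_Un_disjoint)
  ultimately show ?thesis using card_Pow[of "UNIV :: 'i set"] by simp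
qed

text \<open>
  Distinct sets of one or three points differ by a word of weight at most six, so
  they lie in distinct cosets of \<open>C\<close>; since \<open>24 + 2024 = 2 ^ 11\<close>, they represent all cosets of words
  of odd weight. This sphere-packing count is the perfection of the punctured Golay code.
\<close>

lemma golay_odd_set_decomp:
  fixes C :: "'i::finite set set"
  assumes "golay_code C" "odd (card F)"
  obtains T c where "card T = 1 \<or> card T = 3" "c \<in> C" "F = sym_diff T c"
proof -
  note g = golay_codeD[OF assms(1)]
  define T where "T = {T :: 'i set. card T = 1} \<union> {T. card T = 3}"
  have "card T = (24 choose 1) + (24 choose 3)"
    unfolding T_def using n_subsets[of "UNIV :: 'i set" 1] n_subsets[of "UNIV :: 'i set" 3] g(1)
    by (subst card_Un_disjoint) auto
  also have "\<dots> = 2 ^ 11"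
    using times_binomial_minus1_eq[of 3 24] choose_two[of 23] by simp
  finally have card_T: "card T = 2 ^ 11" .
  have inj: "inj_on (\<lambda>(t, c). sym_diff t c) (T \<times> C)"
  proof (rule inj_onI, clarify)
    fix t c t' c'
    assume t: "t \<in> T" "t' \<in> T" and c: "c \<in> C" "c' \<in> C" and eq: "sym_diff t c = sym_diff t' c'"
    have "sym_diff t t' = sym_diff c c'" using eq by blast
    then have "sym_diff t t' \<in> C" using g(3)[OF c] by simp
    moreover have "card (sym_diff t t') < 8"
      using t card_sym_diff[of t t'] by (auto simp: T_def)
    ultimately have "sym_diff t t' = {}" using g(6)[of "sym_diff t t'"] by linarith
    then have "t = t'" by blast
    then show "t = t' \<and> c = c'" using eq by blast
  qed
  have sub: "(\<lambda>(t, c). sym_diff t c) ` (T \<times> C) \<subseteq> {S. odd (card S)}"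
  proof clarify
    fix t c assume "t \<in> T" "c \<in> C" and even: "even (card (sym_diff t c))"
    then have "odd (card t)" "even (card c)"
      using g(5)[of c] dvd_trans[of 2 4 "card c"] by (auto simp: T_def)
    then show False using odd_card_sym_diff[of t c] even by simp
  qed
  have "card ((\<lambda>(t, c). sym_diff t c) ` (T \<times> C)) = 2 ^ 23"
    using card_image[OF inj] card_T g(4) by (simp add: card_cartesian_product)
  moreover have "card {S :: 'i set. odd (card S)} = 2 ^ 23"
    using card_odd_sets[where 'i = 'i] g(1) by simp
  ultimately have "(\<lambda>(t, c). sym_diff t c) ` (T \<times> C) = {S. odd (card S)}"
    using sub by (intro card_subset_eq) auto
  then have "F \<in> (\<lambda>(t, c). sym_diff t c) ` (T \<times> C)" using assms(2) by blast
  then show thesis using that by (auto simp: T_def)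
qed

text \<open>
  Five points of \<open>c\<close> differ from some codeword \<open>q\<close> in one or three points. Then \<open>q\<close> has weight at most
  eight, so it is an octad, and the weights force it to contain the five points. Adding \<open>q\<close> to \<open>c\<close>
  lowers the weight; this is why the octads generate the code.
\<close>

lemma golay_octad_meets:
  fixes C :: "'i::finite set set"
  assumes "golay_code C" "c \<in> C" "c \<noteq> {}"
  obtains q where "q \<in> C" "card q = 8" "5 \<le> card (q \<inter> c)"
proof -
  note g = golay_codeD[OF assms(1)]
  have "8 \<le> card c" using g(6)[OF assms(2,3)] .
  then obtain F where F: "F \<subseteq> c" "card F = 5"
    using obtain_subset_with_card_n[of 5 c] by auto
  then obtain T q where T: "card T = 1 \<or> card T = 3" and q: "q \<in> C" "F = sym_diff T q"
    using golay_odd_set_decomp[OF assms(1), of F] by auto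
  have q_eq: "q = sym_diff F T" using q(2) by blast
  have "card q + 2 * card (F \<inter> T) = 5 + card T"
    unfolding q_eq using card_sym_diff[of F T] F(2) by simp
  moreover have "q \<noteq> {}" using q(2) T F(2) by auto
  then have "8 \<le> card q" using g(6) q(1) by blast
  ultimately have "card q = 8" "card (F \<inter> T) = 0" using T by linarith+
  then have "F \<subseteq> q \<inter> c" using F(1) q_eq by auto
  then have "5 \<le> card (q \<inter> c)" using F(2) card_mono[of "q \<inter> c" F] by simp
  then show thesis using that q(1) \<open>card q = 8\<close> by blast
qed


section \<open>Standard automorphisms and coordinate permutations\<close>

lemma epiI: "f \<in> hom G H \<Longrightarrow> (\<And>y. y \<in> carrier H \<Longrightarrow> y \<in> f ` carrier G) \<Longrightarrow> f \<in> epi G H"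
  by (auto simp: epi_def hom_def)

lemma M24_simps [simp]:
  "p \<in> carrier (M24 C) \<longleftrightarrow> bij p \<and> (image p) ` C = C"
  "p \<otimes>\<^bsub>M24 C\<^esub> q = q \<circ> p" "\<one>\<^bsub>M24 C\<^esub> = id"
  by (simp_all add: M24_def)

lemma M24_comp: "p \<in> carrier (M24 C) \<Longrightarrow> q \<in> carrier (M24 C) \<Longrightarrow> q \<circ> p \<in> carrier (M24 C)"
proof -
  assume "p \<in> carrier (M24 C)" "q \<in> carrier (M24 C)"
  moreover have "(image (q \<circ> p)) ` C = (image q) ` (image p) ` C"
    by (simp add: image_image image_comp)
  ultimately show ?thesis by (simp add: bij_comp)
qed

lemma group_M24: "group (M24 C)"
proof (rule groupI)
  fix p q assume "p \<in> carrier (M24 C)" "q \<in> carrier (M24 C)"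
  then show "p \<otimes>\<^bsub>M24 C\<^esub> q \<in> carrier (M24 C)"
    using M24_comp by (simp del: M24_simps(1))
next
  fix p assume p: "p \<in> carrier (M24 C)"
  then have "inv_into UNIV p ` p ` c = c" for c
    by (simp add: bij_is_inj)
  then have "(image (inv_into UNIV p)) ` (image p) ` C = C"
    by (simp add: image_image)
  with p have "inv_into UNIV p \<in> carrier (M24 C)"
    by (simp add: bij_imp_bij_inv)
  moreover have "p \<circ> inv_into UNIV p = id"
    using p by (simp flip: surj_iff add: bij_is_surj)
  ultimately show "\<exists>q\<in>carrier (M24 C). q \<otimes>\<^bsub>M24 C\<^esub> p = \<one>\<^bsub>M24 C\<^esub>"
    by (intro bexI[of _ "inv_into UNIV p"]) simp_all
qed (auto simp: comp_assoc)

locale golay_parker_loop = parker_loop C P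
  for C :: "'i::finite set set" and P :: "('i, 'p) loop_data" (structure) +
  assumes golay: "golay_code C"
begin

lemma bar_in_code [simp, intro]: "lbar P d \<in> C"
  using bar_surj by blast

lemma obtain_lift:
  assumes "c \<in> C"
  obtains d where "lbar P d = c"
  using assms bar_surj by blast

lemma bar_lsign [simp]: "lbar P (lsign P n d) = lbar P d"
  by (simp add: lsign_def bar_neg)

subsection \<open>The group of standard automorphisms\<close>

lemma Aut_St_simps [simp]:
  "h \<otimes>\<^bsub>Aut_St C P\<^esub> k = k \<circ> h" "\<one>\<^bsub>Aut_St C P\<^esub> = id"
  by (simp_all add: Aut_St_def)

lemma Aut_StI:
  assumes "bij h" "\<And>d e. h (d \<cdot> e) = h d \<cdot> h e" "p \<in> carrier (M24 C)" "\<And>d. lbar P (h d) = p ` lbar P d"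
  shows "h \<in> carrier (Aut_St C P)"
  using assms unfolding Aut_St_def by auto

lemma Aut_StD:
  assumes "h \<in> carrier (Aut_St C P)"
  shows "bij h" "h (d \<cdot> e) = h d \<cdot> h e"
  using assms by (auto simp: Aut_St_def)

text \<open>
  Codewords separate points, so a permutation is determined by its effect on codewords; the definite
  description in \<open>induced_perm\<close> is therefore meaningful.
\<close>

lemma induced_perm_eqI:
  assumes p: "p \<in> carrier (M24 C)" "\<And>d. lbar P (h d) = p ` lbar P d"
  shows "induced_perm C P h = p"
  unfolding induced_perm_def
proof (rule the_equality)
  fix q assume q: "q \<in> carrier (M24 C) \<and> (\<forall>d. lbar P (h d) = q ` lbar P d)"
  show "q = p"
  proof
    fix i
    have "p i \<in> c \<longleftrightarrow> q i \<in> c" if "c \<in> C" for c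
    proof -
      have "c \<in> (image p) ` C" using p(1) that by simp
      then obtain d where "p ` lbar P d = c" using obtain_lift by (metis imageE)
      moreover have "inj p" "inj q" using p(1) q by (auto simp: bij_is_inj)
      moreover have "p ` lbar P d = q ` lbar P d" using p(2) q by metis
      ultimately show ?thesis by (metis inj_image_mem_iff)
    qed
    then show "q i = p i" using golay_separates_points[OF golay, of "p i" "q i"] by simp
  qed
qed (use p in blast)

lemma induced_perm:
  assumes "h \<in> carrier (Aut_St C P)"
  shows "induced_perm C P h \<in> carrier (M24 C)" "lbar P (h d) = induced_perm C P h ` lbar P d"
proof -
  obtain p where p: "p \<in> carrier (M24 C)" "\<And>d. lbar P (h d) = p ` lbar P d"
    using assms by (auto simp: Aut_St_def)
  then have "induced_perm C P h = p" by (rule induced_perm_eqI)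
  with p show "induced_perm C P h \<in> carrier (M24 C)" "lbar P (h d) = induced_perm C P h ` lbar P d"
    by auto
qed

lemma bij_induced_perm: "h \<in> carrier (Aut_St C P) \<Longrightarrow> bij (induced_perm C P h)"
  using induced_perm(1) by simp

lemma group_Aut_St: "group (Aut_St C P)"
proof (rule groupI)
  fix h k assume h: "h \<in> carrier (Aut_St C P)" and k: "k \<in> carrier (Aut_St C P)"
  show "h \<otimes>\<^bsub>Aut_St C P\<^esub> k \<in> carrier (Aut_St C P)"
  proof (rule Aut_StI)
    show "induced_perm C P k \<circ> induced_perm C P h \<in> carrier (M24 C)"
      using h k induced_perm(1) M24_comp by metis
  qed (use h k in \<open>simp_all add: bij_comp Aut_StD induced_perm(2) image_comp\<close>)
next
  show "\<one>\<^bsub>Aut_St C P\<^esub> \<in> carrier (Aut_St C P)"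
    by (rule Aut_StI[where p = id]) auto
next
  fix h assume h: "h \<in> carrier (Aut_St C P)"
  define p where "p = induced_perm C P h"
  interpret M: group "M24 C" by (rule group_M24)
  have p: "p \<in> carrier (M24 C)" using induced_perm(1)[OF h] by (simp add: p_def)
  define q where "q = inv\<^bsub>M24 C\<^esub> p"
  have q: "q \<in> carrier (M24 C)" unfolding q_def using p by (rule M.inv_closed)
  have "q \<circ> p = id" using M.r_inv[OF p] by (simp add: q_def)
  have hinv: "h (inv_into UNIV h d) = d" for d using Aut_StD(1)[OF h] by (simp add: bij_is_surj surj_f_inv_f)
  have "inv_into UNIV h \<in> carrier (Aut_St C P)"
  proof (rule Aut_StI)
    show "bij (inv_into UNIV h)" using Aut_StD(1)[OF h] by (rule bij_imp_bij_inv)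
    show "inv_into UNIV h (d \<cdot> e) = inv_into UNIV h d \<cdot> inv_into UNIV h e" for d e
      by (metis Aut_StD h hinv bij_inv_eq_iff)
    show "lbar P (inv_into UNIV h d) = q ` lbar P d" for d
    proof -
      have "lbar P d = p ` lbar P (inv_into UNIV h d)" using induced_perm(2)[OF h, of "inv_into UNIV h d"] hinv p_def by simp
      then show ?thesis using \<open>q \<circ> p = id\<close> by (simp add: image_comp)
    qed
  qed (rule q)
  moreover have "h \<circ> inv_into UNIV h = id" using hinv by auto
  ultimately show "\<exists>k\<in>carrier (Aut_St C P). k \<otimes>\<^bsub>Aut_St C P\<^esub> h = \<one>\<^bsub>Aut_St C P\<^esub>"
    by (intro bexI[of _ "inv_into UNIV h"]) simp_all
qed (auto simp: comp_assoc)

lemma induced_perm_comp: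
  assumes "h \<in> carrier (Aut_St C P)" "k \<in> carrier (Aut_St C P)"
  shows "induced_perm C P (k \<circ> h) = induced_perm C P k \<circ> induced_perm C P h"
proof (rule induced_perm_eqI)
  show "induced_perm C P k \<circ> induced_perm C P h \<in> carrier (M24 C)"
    using assms induced_perm(1) M24_comp by metis
qed (simp add: induced_perm(2) assms image_comp)

lemma induced_perm_hom: "induced_perm C P \<in> hom (Aut_St C P) (M24 C)"
  using induced_perm(1) induced_perm_comp by (auto simp: hom_def simp del: M24_simps(1))

subsection \<open>Lifting coordinate permutations\<close>

text \<open>
  The graph of a lift of \<open>p\<close> is sought inside the set of pairs \<open>(d, e)\<close> with \<open>e\<close> over \<open>p\<close> of
  the word of \<open>d\<close>. For such pairs the signs in the square, commutator and associator laws agree in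
  both components, because \<open>p\<close> preserves cardinalities of intersections; hence, modulo the pair
  \<open>(-1, -1)\<close>, they form an elementary abelian 2-group. A subgroup of it that is maximal subject to
  avoiding \<open>(1, -1)\<close> is a complement to \<open>(1, -1)\<close>, and its preimage is the graph of an automorphism.
\<close>

lemma lift_perm:
  assumes p: "p \<in> carrier (M24 C)"
  obtains h where "h \<in> carrier (Aut_St C P)" "\<And>d. lbar P (h d) = p ` lbar P d"
proof -
  define nn where "nn x = (lneg P (fst x), lneg P (snd x))" for x :: "'p \<times> 'p"
  define m (infixl "\<odot>" 70) where "m x y = (fst x \<cdot> fst y, snd x \<cdot> snd y)" for x y :: "'p \<times> 'p"
  define Q where "Q = {x. lbar P (snd x) = p ` lbar P (fst x)}"
  define eqv (infix "\<sim>" 50) where "eqv x y \<longleftrightarrow> x = y \<or> x = nn y" for x y :: "'p \<times> 'p"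
  define I where "I = (lone P, lone P)"
  have "inj p" using p by (simp add: bij_is_inj)
  then have card_p: "card (p ` A) = card A" and Int_p: "p ` A \<inter> p ` B = p ` (A \<inter> B)"
    and sd_p: "sym_diff (p ` A) (p ` B) = p ` sym_diff A B" for A B
    by (simp_all add: card_image inj_on_subset image_Int image_set_diff image_Un)
  have p_lift: "\<exists>e. (d, e) \<in> Q" for d
  proof -
    have "p ` lbar P d \<in> C" using p bar_in_code[of d] by auto
    then obtain e where "lbar P e = p ` lbar P d" by (rule obtain_lift)
    then show ?thesis by (auto simp: Q_def)
  qed
  have nn_nn: "nn (nn x) = x" for x by (simp add: nn_def neg_neg)
  have nn_m: "nn x \<odot> y = nn (x \<odot> y)" "x \<odot> nn y = nn (x \<odot> y)" for x y
    by (simp_all add: nn_def m_def neg_mult_left neg_mult_right)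
  have nn_Q: "nn x \<in> Q \<longleftrightarrow> x \<in> Q" for x by (simp add: nn_def Q_def bar_neg)
  have refl: "x \<sim> x" for x by (simp add: eqv_def)
  have sym: "x \<sim> y \<Longrightarrow> y \<sim> x" for x y by (auto simp: eqv_def nn_nn)
  have trans [trans]: "x \<sim> y \<Longrightarrow> y \<sim> z \<Longrightarrow> x \<sim> z" for x y z by (auto simp: eqv_def nn_nn)
  have cong: "x \<odot> y \<sim> x' \<odot> y'" if "x \<sim> x'" "y \<sim> y'" for x y x' y'
    using that by (auto simp: eqv_def nn_m nn_nn)
  have m_Q: "x \<odot> y \<in> Q" if "x \<in> Q" "y \<in> Q" for x y
    using that by (simp add: Q_def m_def bar_mult sd_p)
  have comm: "x \<odot> y \<sim> y \<odot> x" if "x \<in> Q" "y \<in> Q" for x y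
    using commutator[of "fst x" "fst y"] commutator[of "snd x" "snd y"] that
    by (auto simp: Q_def Int_p card_p eqv_def m_def nn_def lsign_def split: if_splits)
  have assoc: "(x \<odot> y) \<odot> z \<sim> x \<odot> (y \<odot> z)" if "x \<in> Q" "y \<in> Q" "z \<in> Q" for x y z
    using associator[of "fst x" "fst y" "fst z"] associator[of "snd x" "snd y" "snd z"] that
    by (auto simp: Q_def Int_p card_p eqv_def m_def nn_def lsign_def split: if_splits)
  have sq: "x \<odot> x \<sim> I" if "x \<in> Q" for x
    using square[of "fst x"] square[of "snd x"] that
    by (auto simp: Q_def card_p eqv_def m_def nn_def lsign_def I_def split: if_splits)
  have one: "I \<odot> x = x" "x \<odot> I = x" for x by (simp_all add: I_def m_def)

  \<comment> \<open>\<open>good\<close> describes the preimages of subgroups modulo \<open>(-1, -1)\<close> that avoid \<open>(1, -1)\<close>.\<close>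
  define good where "good G \<longleftrightarrow> G \<subseteq> Q \<and> I \<in> G \<and> (\<forall>x\<in>G. nn x \<in> G) \<and> (\<forall>x\<in>G. \<forall>y\<in>G. x \<odot> y \<in> G)
    \<and> (lone P, lneg P (lone P)) \<notin> G" for G
  have "lbar P (lone P) = {}" using bar_kernel by simp
  then have "I \<in> Q" by (simp add: I_def Q_def)
  moreover have "(lone P, lneg P (lone P)) \<notin> {I, nn I}"
    using neg_neq[of "lone P"] by (auto simp: I_def nn_def)
  ultimately have "good {I, nn I}"
    by (auto simp: good_def nn_Q nn_m one nn_nn)
  then obtain G where G: "good G" and max: "\<And>G'. good G' \<Longrightarrow> G \<subseteq> G' \<Longrightarrow> G' = G"
  proof -
    have "finite (UNIV :: ('p \<times> 'p) set)"
      using finite_lifts by (metis UNIV_Times_UNIV finite_cartesian_product)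
    then have "finite (Collect good)"
      by (meson Finite_Set.finite_set finite_subset top_greatest)
    then obtain G where "good G" "\<forall>G'\<in>Collect good. G \<subseteq> G' \<longrightarrow> G = G'"
      using finite_has_maximal[of "Collect good"] \<open>good {I, nn I}\<close> by auto
    then show thesis using that by blast
  qed
  have G_Q: "x \<in> Q" and G_nn: "nn x \<in> G" if "x \<in> G" for x using G that by (auto simp: good_def)
  have G_m: "x \<odot> y \<in> G" if "x \<in> G" "y \<in> G" for x y using G that by (auto simp: good_def)
  have G_I: "I \<in> G" and G_not: "(lone P, lneg P (lone P)) \<notin> G" using G by (auto simp: good_def)
  have G_eqv: "x \<in> G" if "x \<sim> y" "y \<in> G" for x y using that G_nn[of y] unfolding eqv_def by blast

  have total: "\<exists>e. (d, e) \<in> G" for d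
  proof (rule ccontr)
    assume none: "\<nexists>e. (d, e) \<in> G"
    obtain e where "(d, e) \<in> Q" using p_lift by blast
    define a where "a = (d, e)"
    have a: "a \<in> Q" using \<open>(d, e) \<in> Q\<close> by (simp add: a_def)
    \<comment> \<open>Enlarge \<open>G\<close> by the coset of \<open>a\<close>, contradicting maximality.\<close>
    define G' where "G' = G \<union> {y. \<exists>x\<in>G. y \<sim> x \<odot> a}"
    have x_ya: "x \<odot> (y \<odot> a) \<sim> (x \<odot> y) \<odot> a" if "x \<in> G" "y \<in> G" for x y
      using assoc[of x y a] that G_Q a sym by blast
    have xa_y: "(x \<odot> a) \<odot> y \<sim> (x \<odot> y) \<odot> a" if "x \<in> G" "y \<in> G" for x y
    proof -
      have "(x \<odot> a) \<odot> y \<sim> x \<odot> (a \<odot> y)" using assoc that G_Q a by blast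
      also have "\<dots> \<sim> x \<odot> (y \<odot> a)" using cong[OF refl comm] that G_Q a by blast
      also have "\<dots> \<sim> (x \<odot> y) \<odot> a" using x_ya that .
      finally show ?thesis .
    qed
    have xa_ya: "(x \<odot> a) \<odot> (y \<odot> a) \<sim> x \<odot> y" if "x \<in> G" "y \<in> G" for x y
    proof -
      have "(x \<odot> a) \<odot> (y \<odot> a) \<sim> ((x \<odot> a) \<odot> y) \<odot> a" 
        using sym[OF assoc[OF m_Q[OF G_Q[OF that(1)] a] G_Q[OF that(2)] a]] .
      also have "\<dots> \<sim> ((x \<odot> y) \<odot> a) \<odot> a" using cong[OF xa_y[OF that] refl] .
      also have "\<dots> \<sim> (x \<odot> y) \<odot> (a \<odot> a)" 
        using assoc[OF m_Q[OF G_Q[OF that(1)] G_Q[OF that(2)]] a a] .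
      also have "\<dots> \<sim> (x \<odot> y) \<odot> I" using cong[OF refl sq[OF a]] .
      finally show ?thesis by (simp add: one)
    qed
    have "(lone P, lneg P (lone P)) \<notin> G'"
    proof
      assume "(lone P, lneg P (lone P)) \<in> G'"
      then obtain x where x: "x \<in> G" "(lone P, lneg P (lone P)) \<sim> x \<odot> a"
        using G_not by (auto simp: G'_def)
      then have "lbar P (fst x \<cdot> d) = {}"
        using \<open>lbar P (lone P) = {}\<close> by (auto simp: eqv_def m_def a_def nn_def bar_neg)
      then have "lbar P d = lbar P (fst x)" by (auto simp: bar_mult)
      then have "d = fst x \<or> d = fst (nn x)" by (simp add: bar_eq_iff nn_def)
      then show False using none x(1) G_nn by (metis prod.collapse)
    qed
    moreover have "x \<odot> y \<in> G'" if "x \<in> G'" "y \<in> G'" for x y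
      using that unfolding G'_def
      by (auto intro: G_m; meson G_eqv G_m cong refl trans x_ya xa_y xa_ya)
    moreover have "x \<in> Q" if "x \<in> G'" for x
      using that G_Q m_Q[OF _ a] nn_Q unfolding G'_def eqv_def by blast
    moreover have "nn x \<in> G'" if "x \<in> G'" for x
      using that G_nn nn_nn unfolding G'_def eqv_def by blast
    moreover have "I \<in> G'" using G_I by (simp add: G'_def)
    ultimately have "good G'" unfolding good_def by blast
    then have "G' = G" using max[of G'] by (auto simp: G'_def)
    moreover have "a \<in> G'" using G_I refl[of a] by (auto simp: G'_def one intro!: bexI[of _ I])
    ultimately show False using none by (auto simp: a_def)
  qed
  have functional: "e = e'" if "(d, e) \<in> G" "(d, e') \<in> G" for d e e'
  proof (rule ccontr)
    assume "e \<noteq> e'"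
    have "lbar P e = lbar P e'" using that G_Q by (force simp: Q_def)
    then have e': "e' = lneg P e" using \<open>e \<noteq> e'\<close> bar_eq_iff[of e' e] by auto
    have "(d, e) \<odot> (d, e) \<sim> I" using sq G_Q that(1) by blast
    then have "(d, e) \<odot> (d, e') \<sim> (lone P, lneg P (lone P))"
      by (auto simp: e' m_def neg_mult_right eqv_def I_def nn_def neg_neg)
    then show False using G_eqv sym G_m[OF that] G_not by blast
  qed
  define h where "h d = (THE e. (d, e) \<in> G)" for d
  have hI: "h d = e" if "(d, e) \<in> G" for d e
    unfolding h_def using that functional by blast
  have hG: "(d, h d) \<in> G" for d using total[of d] hI by auto
  have h_bar: "lbar P (h d) = p ` lbar P d" for d using hG G_Q by (force simp: Q_def)
  have h_neg: "h (lneg P d) = lneg P (h d)" for d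
    using G_nn[OF hG[of d]] by (intro hI) (simp add: nn_def)
  have "inj h"
  proof (rule injI)
    fix d e assume eq: "h d = h e"
    then have "p ` lbar P d = p ` lbar P e" using h_bar by metis
    then have "lbar P d = lbar P e" using \<open>inj p\<close> by (simp add: inj_image_eq_iff)
    then have "d = e \<or> d = lneg P e" by (simp add: bar_eq_iff)
    then show "d = e" using eq h_neg neg_neq by metis
  qed
  then have "bij h" by (simp add: bij_def finite_lifts finite_UNIV_inj_surj)
  moreover have "h (d \<cdot> e) = h d \<cdot> h e" for d e
    using G_m[OF hG[of d] hG[of e]] by (intro hI) (simp add: m_def)
  ultimately show thesis using that p h_bar Aut_StI by blast
qed

end


section \<open>Subgroups of index two\<close>

lemma UNIV_bit: "(UNIV :: bit set) = {0, 1}"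
proof -
  have "b = 0 \<or> b = 1" for b :: bit by (cases b) simp_all
  then show ?thesis by blast
qed

definition bit_group :: "bit monoid" where
  "bit_group = \<lparr>carrier = UNIV, mult = (+), one = 0\<rparr>"

lemma card_bit_group: "card (carrier bit_group) = 2"
  by (simp add: bit_group_def UNIV_bit)

lemma group_bit_group: "group bit_group"
  by (rule groupI) (auto simp: bit_group_def ac_simps)

context group
begin

lemma bit_hom_kernel:
  fixes \<theta> :: "'a \<Rightarrow> bit"
  assumes add: "\<And>x y. x \<in> carrier G \<Longrightarrow> y \<in> carrier G \<Longrightarrow> \<theta> (x \<otimes> y) = \<theta> x + \<theta> y"
    and t: "t \<in> carrier G" "\<theta> t = 1"
  shows "subgroup {x \<in> carrier G. \<theta> x = 0} G"
    and "card (rcosets {x \<in> carrier G. \<theta> x = 0}) = 2"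
    and "order G = 2 * card {x \<in> carrier G. \<theta> x = 0}"
proof -
  interpret hom: group_hom G bit_group \<theta>
    by (rule group_hom.intro[OF is_group group_bit_group], unfold_locales)
      (auto simp: hom_def bit_group_def add)
  have ker: "kernel G bit_group \<theta> = {x \<in> carrier G. \<theta> x = 0}"
    by (simp add: kernel_def bit_group_def)
  show sub: "subgroup {x \<in> carrier G. \<theta> x = 0} G"
    using hom.subgroup_kernel by (simp add: ker)
  have "\<theta> \<one> = 0" using hom.hom_one by (simp add: bit_group_def)
  then have "{0, 1} \<subseteq> \<theta> ` carrier G"
    using imageI[where f = \<theta>, OF one_closed] imageI[where f = \<theta>, OF t(1)] t(2) by simp
  then have "\<theta> ` carrier G = carrier bit_group"
    by (auto simp: bit_group_def UNIV_bit)
  then have "G Mod kernel G bit_group \<theta> \<cong> bit_group" by (rule hom.FactGroup_iso)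
  then have "card (carrier (G Mod kernel G bit_group \<theta>)) = card (carrier bit_group)"
    by (rule iso_same_card)
  then show "card (rcosets {x \<in> carrier G. \<theta> x = 0}) = 2"
    unfolding ker by (simp add: FactGroup_def card_bit_group)
  then show "order G = 2 * card {x \<in> carrier G. \<theta> x = 0}"
    using lagrange[OF sub] by simp
qed

end

lemma elementary_abelian_bit_hom_kernel:
  fixes \<theta> :: "'a \<Rightarrow> bit" and G :: "('a, 'b) monoid_scheme"
  assumes G: "elementary_abelian_2_group (Suc n) G"
    and add: "\<And>x y. x \<in> carrier G \<Longrightarrow> y \<in> carrier G \<Longrightarrow> \<theta> (x \<otimes>\<^bsub>G\<^esub> y) = \<theta> x + \<theta> y"
    and t: "t \<in> carrier G" "\<theta> t = 1"
  shows "elementary_abelian_2_group n (G\<lparr>carrier := {x \<in> carrier G. \<theta> x = 0}\<rparr>)"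
proof -
  interpret comm_group G using G by (simp add: elementary_abelian_2_group_def)
  note ker = bit_hom_kernel[of \<theta>, OF add t]
  have "comm_group (G\<lparr>carrier := {x \<in> carrier G. \<theta> x = 0}\<rparr>)"
    by (rule group.group_comm_groupI[OF subgroup.subgroup_is_group[OF ker(1) is_group]])
      (auto intro: m_comm)
  then show ?thesis
    using G ker(3) by (auto simp: elementary_abelian_2_group_def order_def)
qed


section \<open>The kernel on coordinates\<close>

definition word_group :: "'i set monoid" where
  "word_group = \<lparr>carrier = UNIV, mult = sym_diff, one = {}\<rparr>"

lemma group_word_group: "group word_group"
proof (rule groupI)
  fix S :: "'i set"
  show "\<exists>T\<in>carrier word_group. T \<otimes>\<^bsub>word_group\<^esub> S = \<one>\<^bsub>word_group\<^esub>"
    by (rule bexI[of _ S]) (auto simp: word_group_def)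
qed (auto simp: word_group_def)

context golay_parker_loop
begin

text \<open>
  Only the coset of \<open>S\<close> modulo \<open>C\<close> matters, by self-duality of \<open>C\<close>; this is how the cocode acts on
  the loop.
\<close>

definition sign_aut :: "'i set \<Rightarrow> 'p \<Rightarrow> 'p" where
  "sign_aut S d = lsign P (card (S \<inter> lbar P d)) d"

lemma bar_sign_aut: "lbar P (sign_aut S d) = lbar P d"
  by (simp add: sign_aut_def)

lemma sign_aut_comp: "sign_aut S \<circ> sign_aut T = sign_aut (sym_diff S T)"
  using odd_card_Int_sym_diff(2)[of S T]
  by (auto simp: fun_eq_iff sign_aut_def lsign_def bar_neg neg_neg)

lemma sign_aut_involution: "sign_aut S \<circ> sign_aut S = id"
  unfolding sign_aut_comp by (simp add: fun_eq_iff sign_aut_def lsign_def)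

lemma sign_aut_mult: "sign_aut S (d \<cdot> e) = sign_aut S d \<cdot> sign_aut S e"
  using odd_card_Int_sym_diff(1)[of S "lbar P d" "lbar P e"]
  by (auto simp: sign_aut_def lsign_def bar_mult neg_mult_left neg_mult_right neg_neg)

lemma id_in_M24: "id \<in> carrier (M24 C)"
  by simp

lemma sign_aut_in_Aut_St: "sign_aut S \<in> carrier (Aut_St C P)"
proof (rule Aut_StI[OF _ _ id_in_M24])
  show "bij (sign_aut S)" using sign_aut_involution o_bij by blast
qed (simp_all add: sign_aut_mult bar_sign_aut)

lemma induced_perm_sign_aut: "induced_perm C P (sign_aut S) = id"
  by (rule induced_perm_eqI) (simp_all add: bar_sign_aut)

lemma eps_sign_aut: "eps P (sign_aut S) = (if even (card S) then 0 else 1)"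
  using neg_neq[of "lOmega P"] by (simp add: eps_def sign_aut_def lsign_def bar_Omega)

lemma sign_aut_eq_id_iff: "sign_aut S = id \<longleftrightarrow> S \<in> C"
proof -
  have "sign_aut S d = d \<longleftrightarrow> even (card (S \<inter> lbar P d))" for d
    using neg_neq[of d] by (simp add: sign_aut_def lsign_def)
  then have "sign_aut S = id \<longleftrightarrow> (\<forall>c\<in>C. even (card (S \<inter> c)))"
    unfolding fun_eq_iff bar_surj[symmetric] by simp
  then show ?thesis using golay_self_dual[OF golay] by simp
qed

text \<open>
  An automorphism over the identity of \<open>C\<close> multiplies each element by a sign that depends
  additively on its word, and every additive functional on \<open>C\<close> is a parity.
\<close>

lemma kernel_induced_perm:
  "kernel (Aut_St C P) (M24 C) (induced_perm C P) = range sign_aut"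
proof (intro equalityI subsetI)
  fix h assume "h \<in> kernel (Aut_St C P) (M24 C) (induced_perm C P)"
  then have h: "h \<in> carrier (Aut_St C P)" and bar_h: "lbar P (h d) = lbar P d" for d
    using induced_perm(2) by (auto simp: kernel_def)
  then have h_cases: "h d = d \<or> h d = lneg P d" for d
    using bar_eq_iff by blast
  define f where "f c \<longleftrightarrow> (\<exists>d. lbar P d = c \<and> h d \<noteq> d)" for c
  have f: "f (lbar P d) \<longleftrightarrow> h d \<noteq> d" for d
    by (auto simp: f_def bar_eq_iff Aut_St_neg[OF h])
  have "f (sym_diff c e) \<longleftrightarrow> f c \<noteq> f e" if words: "c \<in> C" "e \<in> C" for c e
  proof -
    obtain x where "c = lbar P x" using words(1) bar_surj by blast
    moreover obtain y where "e = lbar P y" using words(2) bar_surj by blast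
    ultimately have c: "c = lbar P x" "e = lbar P y" .
    have "f (lbar P (x \<cdot> y)) \<longleftrightarrow> f (lbar P x) \<noteq> f (lbar P y)"
      unfolding f using h_cases[of x] h_cases[of y] neg_neq
      by (auto simp: Aut_StD(2)[OF h] neg_mult_left neg_mult_right neg_neg)
    then show ?thesis by (simp add: c bar_mult)
  qed
  then obtain S where S: "\<And>c. c \<in> C \<Longrightarrow> odd (card (S \<inter> c)) \<longleftrightarrow> f c"
    using golay_functional_is_parity[OF golay] by blast
  have "h d = sign_aut S d" for d
    using S[OF bar_in_code[of d]] f[of d] h_cases[of d] by (auto simp: sign_aut_def lsign_def)
  then show "h \<in> range sign_aut" by blast
qed (auto simp: kernel_def sign_aut_in_Aut_St induced_perm_sign_aut)

abbreviation "sign_group \<equiv>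
  (Aut_St C P)\<lparr>carrier := kernel (Aut_St C P) (M24 C) (induced_perm C P)\<rparr>"

lemma group_sign_group: "group sign_group"
proof -
  interpret group_hom "Aut_St C P" "M24 C" "induced_perm C P"
    by (intro group_hom.intro group_hom_axioms.intro group_Aut_St group_M24 induced_perm_hom)
  show ?thesis by (rule subgroup.subgroup_is_group[OF subgroup_kernel group_Aut_St])
qed

lemma cocode_iso: "cocode C \<cong> sign_group"
  and elementary_abelian_sign_group: "elementary_abelian_2_group 12 sign_group"
proof -
  have comm: "sym_diff S T = sym_diff T S" for S T :: "'i set" by blast
  interpret group_hom word_group sign_group sign_aut
    by (intro group_hom.intro group_hom_axioms.intro group_word_group group_sign_group)
      (auto simp: hom_def kernel_induced_perm word_group_def sign_aut_comp comm)
  have ker: "kernel word_group sign_group sign_aut = C"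
    by (auto simp: kernel_def word_group_def sign_aut_eq_id_iff)
  have "sign_aut ` carrier word_group = carrier sign_group"
    by (simp add: word_group_def kernel_induced_perm)
  from FactGroup_iso[OF this] have iso: "word_group Mod C \<cong> sign_group" by (simp add: ker)
  then show "cocode C \<cong> sign_group" by (simp add: cocode_def word_group_def)
  have "comm_group sign_group"
    by (rule group.group_comm_groupI[OF group_sign_group])
      (auto simp: kernel_induced_perm sign_aut_comp comm)
  moreover have "order sign_group = 2 ^ 12"
  proof -
    have "card (rcosets\<^bsub>word_group\<^esub> C) * card C = order (word_group :: 'i set monoid)"
      using G.lagrange[OF subgroup_kernel] by (simp add: ker)
    moreover have "order (word_group :: 'i set monoid) = 2 ^ 24"
      using card_Pow[of "UNIV :: 'i set"] golay_codeD(1)[OF golay] by (simp add: order_def word_group_def)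
    ultimately show ?thesis
      using iso_same_card[OF iso] golay_codeD(4)[OF golay] by (simp add: order_def FactGroup_def)
  qed
  ultimately show "elementary_abelian_2_group 12 sign_group"
    by (auto simp: elementary_abelian_2_group_def kernel_induced_perm sign_aut_involution)
qed

subsection \<open>The sign of \<open>\<Omega>\<close>\<close>

lemma eps_comp:
  assumes "h \<in> carrier (Aut_St C P)" "k \<in> carrier (Aut_St C P)"
  shows "eps P (k \<circ> h) = eps P h + eps P k"
proof -
  have "(k \<circ> h) (lOmega P) =
      (if eps P h + eps P k = 0 then lOmega P else lneg P (lOmega P))"
    using Aut_St_Omega[OF assms(1)] Aut_St_Omega[OF assms(2)] Aut_St_neg[OF assms(2)]
    by (auto simp: neg_neg)
  then show ?thesis
    using neg_neq[of "lOmega P"] unfolding eps_def[of P "k \<circ> h"]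
    by (cases "eps P h + eps P k") auto
qed

text \<open>A single point has odd weight, hence its sign automorphism negates \<open>\<Omega>\<close>.\<close>

lemma odd_sign_aut: "\<exists>S. eps P (sign_aut S) = 1"
  by (rule exI[of _ "{undefined}"]) (simp add: eps_sign_aut)

lemma Aut_St_plus_index_two:
  "subgroup (carrier (Aut_St_plus C P)) (Aut_St C P)"
  "card (rcosets\<^bsub>Aut_St C P\<^esub> (carrier (Aut_St_plus C P))) = 2"
proof -
  interpret group "Aut_St C P" by (rule group_Aut_St)
  obtain S where "eps P (sign_aut S) = 1" using odd_sign_aut by blast
  note ker = bit_hom_kernel[of "eps P", OF _ sign_aut_in_Aut_St this]
  show "subgroup (carrier (Aut_St_plus C P)) (Aut_St C P)"
    "card (rcosets\<^bsub>Aut_St C P\<^esub> (carrier (Aut_St_plus C P))) = 2"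
    using ker(1,2) eps_comp by (simp_all add: Aut_St_plus_def)
qed

lemma elementary_abelian_sign_group_plus:
  "elementary_abelian_2_group 11
     ((Aut_St_plus C P)\<lparr>carrier := kernel (Aut_St_plus C P) (M24 C) (induced_perm C P)\<rparr>)"
proof -
  obtain S where "eps P (sign_aut S) = 1" using odd_sign_aut by blast
  then have "elementary_abelian_2_group 11 (sign_group\<lparr>carrier := {h \<in> carrier sign_group. eps P h = 0}\<rparr>)"
    using elementary_abelian_sign_group eps_comp sign_aut_in_Aut_St
    by (intro elementary_abelian_bit_hom_kernel[of _ _ _ "sign_aut S"])
      (auto simp: kernel_induced_perm)
  moreover have "{h \<in> carrier sign_group. eps P h = 0}
      = kernel (Aut_St_plus C P) (M24 C) (induced_perm C P)"
    by (auto simp: kernel_def Aut_St_plus_def)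
  ultimately show ?thesis by (simp add: Aut_St_plus_def)
qed

lemma induced_perm_epi: "induced_perm C P \<in> epi (Aut_St C P) (M24 C)"
proof (rule epiI[OF induced_perm_hom])
  fix p assume p: "p \<in> carrier (M24 C)"
  then obtain h where "h \<in> carrier (Aut_St C P)" "\<And>d. lbar P (h d) = p ` lbar P d"
    using lift_perm by blast
  then show "p \<in> induced_perm C P ` carrier (Aut_St C P)"
    using induced_perm_eqI[OF p] by (metis imageI)
qed

text \<open>A lift that moves \<open>\<Omega>\<close> is corrected by a sign automorphism that moves \<open>\<Omega>\<close>.\<close>

lemma induced_perm_epi_plus: "induced_perm C P \<in> epi (Aut_St_plus C P) (M24 C)"
proof (rule epiI)
  show "induced_perm C P \<in> hom (Aut_St_plus C P) (M24 C)"
    using induced_perm_hom by (auto simp: hom_def Aut_St_plus_def)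
next
  fix p assume "p \<in> carrier (M24 C)"
  then have "p \<in> induced_perm C P ` carrier (Aut_St C P)"
    using induced_perm_epi by (simp add: epi_def del: M24_simps)
  then obtain h where h: "h \<in> carrier (Aut_St C P)" "p = induced_perm C P h"
    by blast
  obtain S where S: "eps P (sign_aut S) = 1" using odd_sign_aut by blast
  let ?k = "sign_aut S \<circ> h"
  have k: "?k \<in> carrier (Aut_St C P)" "eps P ?k = eps P h + 1" "p = induced_perm C P ?k"
    using group.subgroup_self[OF group_Aut_St, THEN subgroup.m_closed, OF h(1) sign_aut_in_Aut_St]
      eps_comp[OF h(1) sign_aut_in_Aut_St] induced_perm_comp[OF h(1) sign_aut_in_Aut_St]
    by (simp_all add: S h(2) induced_perm_sign_aut)
  show "p \<in> induced_perm C P ` carrier (Aut_St_plus C P)"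
  proof (cases "eps P h = 0")
    case True
    then show ?thesis using h by (auto simp: Aut_St_plus_def)
  next
    case False
    then have "?k \<in> carrier (Aut_St_plus C P)" using k by (simp add: Aut_St_plus_def)
    then show ?thesis using k(3) by blast
  qed
qed

end


section \<open>Semilinear automorphisms\<close>

lemma semilinear_onD:
  assumes "semilinear_on \<sigma> A f"
  shows "v \<in> A \<Longrightarrow> w \<in> A \<Longrightarrow> f (v + w) = f v + f w" "v \<in> A \<Longrightarrow> f (c *\<^sub>E v) = \<sigma> c *\<^sub>E f v"
  using assms by (simp_all add: semilinear_on_def)

lemma semilinear_on_cong:
  assumes "\<And>v w. v \<in> A \<Longrightarrow> w \<in> A \<Longrightarrow> v + w \<in> A" "\<And>c v. v \<in> A \<Longrightarrow> c *\<^sub>E v \<in> A"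
    and "\<And>v. v \<in> A \<Longrightarrow> f v = g v"
  shows "semilinear_on \<sigma> A f \<longleftrightarrow> semilinear_on \<sigma> A g"
  using assms by (simp add: semilinear_on_def)

lemma semilinear_on_compose:
  assumes A: "\<And>v w. v \<in> A \<Longrightarrow> w \<in> A \<Longrightarrow> v + w \<in> A" "\<And>c v. v \<in> A \<Longrightarrow> c *\<^sub>E v \<in> A"
    and g: "semilinear_on \<sigma> A g" "\<And>v. v \<in> A \<Longrightarrow> g v \<in> A" and f: "semilinear_on \<tau> A f"
  shows "semilinear_on (\<tau> \<circ> \<sigma>) A (compose A f g)"
  using A g(2) semilinear_onD[OF g(1)] semilinear_onD[OF f]
  by (simp add: semilinear_on_def compose_def)

lemma semilinear_on_inv_into:
  assumes A: "\<And>v w. v \<in> A \<Longrightarrow> w \<in> A \<Longrightarrow> v + w \<in> A" "\<And>c v. v \<in> A \<Longrightarrow> c *\<^sub>E v \<in> A"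
    and f: "semilinear_on \<sigma> A f" "f \<in> Bij A" and \<sigma>: "\<And>c. \<sigma> (\<sigma> c) = c"
  shows "semilinear_on \<sigma> A (restrict (inv_into A f) A)"
proof -
  have f_A: "f ` A = A" and inj: "inj_on f A" using f(2) by (auto simp: Bij_def bij_betw_def)
  have "inv_into A f (f v + f w) = inv_into A f (f v) + inv_into A f (f w)"
    if "v \<in> A" "w \<in> A" for v w
    using that A(1) inj by (simp flip: semilinear_onD(1)[OF f(1)])
  moreover have "inv_into A f (c *\<^sub>E f v) = \<sigma> c *\<^sub>E inv_into A f (f v)" if "v \<in> A" for c v
  proof -
    have "c *\<^sub>E f v = f (\<sigma> c *\<^sub>E v)" using semilinear_onD(2)[OF f(1) that] \<sigma> by simp
    then show ?thesis using that A(2) inj by simp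
  qed
  ultimately have "semilinear_on \<sigma> (f ` A) (inv_into A f)"
    by (auto simp: semilinear_on_def)
  then show ?thesis
    using semilinear_on_cong[OF A, of "restrict (inv_into A f) A" "inv_into A f" \<sigma>] by (simp add: f_A)
qed

context golay_parker_loop
begin

lemma card_coordinates: "CARD('i) = 24"
  using golay_codeD(1)[OF golay] .

lemma group_Aut_sl: "group (Aut_sl P)"
proof -
  let ?A = "alg P" and ?H = "carrier (Aut_sl P)"
  have H: "f \<in> ?H \<longleftrightarrow> f \<in> Bij ?A \<and> (linear_on_alg P f \<or> conj_linear_on_alg P f) \<and>
      (\<forall>v\<in>?A. \<forall>w\<in>?A. f (prd P v w) = prd P (f v) (f w))" for f
    by (simp add: Aut_sl_def)
  note [simp] = prd_in_alg[OF card_coordinates]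
  interpret B: group "BijGroup ?A" by (rule group_BijGroup)
  have "subgroup ?H (BijGroup ?A)"
  proof (rule subgroup.intro)
    show "?H \<subseteq> carrier (BijGroup ?A)" by (auto simp: H BijGroup_def)
  next
    fix f g assume f: "f \<in> ?H" and g: "g \<in> ?H"
    have B: "f \<in> Bij ?A" "g \<in> Bij ?A" using f g by (auto simp: H)
    have gA: "g v \<in> ?A" if "v \<in> ?A" for v using Bij_imp_funcset[OF B(2)] that by blast
    obtain \<sigma> where \<sigma>: "\<sigma> = (\<lambda>c. c) \<or> \<sigma> = eis_cnj" "semilinear_on \<sigma> ?A g" using g unfolding H by blast
    obtain \<tau> where \<tau>: "\<tau> = (\<lambda>c. c) \<or> \<tau> = eis_cnj" "semilinear_on \<tau> ?A f" using f unfolding H by blast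
    have "semilinear_on (\<tau> \<circ> \<sigma>) ?A (compose ?A f g)"
      by (rule semilinear_on_compose[OF alg_add alg_scal \<sigma>(2) gA \<tau>(2)])
    then have "linear_on_alg P (compose ?A f g) \<or> conj_linear_on_alg P (compose ?A f g)"
      using \<sigma>(1) \<tau>(1) by (auto simp: comp_def)
    moreover have "compose ?A f g (prd P v w) = prd P (compose ?A f g v) (compose ?A f g w)"
      if "v \<in> ?A" "w \<in> ?A" for v w
      using f g gA that by (simp add: H compose_def)
    ultimately have "compose ?A f g \<in> ?H" using compose_Bij[OF B] by (simp add: H)
    then show "f \<otimes>\<^bsub>BijGroup ?A\<^esub> g \<in> ?H" using B by (simp add: BijGroup_def)
  next
    show "\<one>\<^bsub>BijGroup ?A\<^esub> \<in> ?H"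
      by (auto simp: H BijGroup_def id_Bij semilinear_on_def alg_add alg_scal)
  next
    fix f assume f: "f \<in> ?H"
    then have B: "f \<in> Bij ?A" by (simp add: H)
    let ?g = "restrict (inv_into ?A f) ?A"
    have "linear_on_alg P ?g \<or> conj_linear_on_alg P ?g"
      using f semilinear_on_inv_into[OF alg_add alg_scal _ B] by (auto simp: H)
    moreover have "?g (prd P v w) = prd P (?g v) (?g w)" if "v \<in> ?A" "w \<in> ?A" for v w
      using Bij_inv_into_lemma[of ?A f "prd P" v w] f B that by (simp add: H)
    ultimately have "?g \<in> ?H" using restrict_inv_into_Bij[OF B] by (simp add: H)
    then show "inv\<^bsub>BijGroup ?A\<^esub> f \<in> ?H" by (simp add: inv_BijGroup[OF B])
  qed
  then have "group (BijGroup ?A\<lparr>carrier := ?H\<rparr>)"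
    by (rule subgroup.subgroup_is_group[OF _ group_BijGroup])
  then show ?thesis by (simp add: Aut_sl_def)
qed


section \<open>The action on the algebra\<close>

lemma eps_conj_numeral [simp]: "eps_conj e (numeral n) = numeral n"
  and eps_conj_divide [simp]: "eps_conj e (x / y) = eps_conj e x / eps_conj e y"
  and eps_conj_eps_conj: "eps_conj e (eps_conj e' x) = eps_conj (e' + e) x"
  and eps_conj_eis_cnj: "eps_conj e (eis_cnj x) = eis_cnj (eps_conj e x)"
  and eps_conj_theta: "eps_conj e eis_theta = (if e = 0 then eis_theta else - eis_theta)"
  by (cases e; cases e'; simp add: eps_conj_def)+

lemma act_minus: "act C P h (- v) = - act C P h v"
  using act_scal[of h "- 1" v] by simp

lemma act_zero: "act C P h 0 = 0"
  using act_scal[of h 0 0] by simp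

lemma act_diff: "act C P h (v - w) = act C P h v - act C P h w"
  using act_add[of h v "- w"] by (simp add: act_minus)

lemma act_sum: "act C P h (sum f S) = (\<Sum>s\<in>S. act C P h (f s))"
  by (induction S rule: infinite_finite_induct) (simp_all add: act_zero act_add)

lemma Aut_St_octad_lifts:
  assumes "h \<in> carrier (Aut_St C P)"
  shows "h d \<in> octad_lifts P \<longleftrightarrow> d \<in> octad_lifts P"
  using card_image[OF inj_on_subset[OF bij_is_inj[OF bij_induced_perm[OF assms]] subset_UNIV]]
  by (simp add: octad_lifts_def induced_perm(2)[OF assms])

lemma act_in_alg:
  assumes "h \<in> carrier (Aut_St C P)"
  shows "act C P h v \<in> alg P"
  unfolding act_def
  by (intro alg_add alg_sum alg_scal uvec_in_alg xvec_in_alg) (simp add: Aut_St_octad_lifts[OF assms])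

lemma act_id: "v \<in> alg P \<Longrightarrow> act C P id v = v"
proof -
  have "induced_perm C P id = id" by (rule induced_perm_eqI) auto
  moreover assume "v \<in> alg P"
  ultimately show ?thesis
    using alg_expand[of v] by (simp add: act_def eps_def eps_conj_def)
qed

lemma act_comp:
  assumes "h \<in> carrier (Aut_St C P)" "k \<in> carrier (Aut_St C P)"
  shows "act C P (k \<circ> h) v = act C P k (act C P h v)"
proof -
  have "act C P k (act C P h v)
    = (\<Sum>i\<in>UNIV. eps_conj (eps P k) (eps_conj (eps P h) (fst v i)) *\<^sub>E
          uvec (induced_perm C P k (induced_perm C P h i)))
    + (\<Sum>d\<in>octad_lifts P. (1 / 2 * eps_conj (eps P k) (eps_conj (eps P h) (snd v d))) *\<^sub>E xvec P (k (h d)))"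
    unfolding act_def[of C P h]
    by (simp add: act_add act_sum act_scal act_uvec act_xvec[OF assms(2)] Aut_St_octad_lifts[OF assms(1)])
  then show ?thesis
    by (simp add: act_def[of C P "k \<circ> h"] eps_comp[OF assms] induced_perm_comp[OF assms] eps_conj_eps_conj)
qed

lemma act_inv:
  assumes h: "h \<in> carrier (Aut_St C P)" and v: "v \<in> alg P"
  shows "act C P (inv\<^bsub>Aut_St C P\<^esub> h) (act C P h v) = v" "act C P h (act C P (inv\<^bsub>Aut_St C P\<^esub> h) v) = v"
proof -
  interpret group "Aut_St C P" by (rule group_Aut_St)
  show "act C P (inv\<^bsub>Aut_St C P\<^esub> h) (act C P h v) = v" "act C P h (act C P (inv\<^bsub>Aut_St C P\<^esub> h) v) = v"
    using act_comp[OF h inv_closed[OF h], of v] act_comp[OF inv_closed[OF h] h, of v]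
      r_inv[OF h] l_inv[OF h] act_id[OF v] by simp_all
qed

lemma semilinear_act:
  "semilinear_on (eps_conj (eps P h)) A (act C P h)"
  by (simp add: semilinear_on_def act_add act_scal)

subsection \<open>Multiplicativity\<close>

text \<open>
  Both sides of the product formula are semilinear in each argument, which reduces it to the tables.
\<close>

lemma semilinear_eqI:
  assumes F: "\<And>v w. F (v + w) = F v + F w" "\<And>c v. F (c *\<^sub>E v) = \<tau> c *\<^sub>E F v"
    and G: "\<And>v w. G (v + w) = G v + G w" "\<And>c v. G (c *\<^sub>E v) = \<tau> c *\<^sub>E G v"
    and u: "\<And>i. F (uvec i) = G (uvec i)"
    and x: "\<And>d. d \<in> octad_lifts P \<Longrightarrow> F (xvec P d) = G (xvec P d)"
    and v: "v \<in> alg P"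
  shows "F v = (G v :: ('i, 'p) vec)"
proof -
  have sums: "T (sum f S) = (\<Sum>s\<in>S. T (f s))"
    if "\<And>v w. T (v + w) = T v + T w" for T :: "('i, 'p) vec \<Rightarrow> ('i, 'p) vec" and f :: "'s \<Rightarrow> _" and S
  proof -
    have "T 0 = 0" using that[of 0 0] by simp
    then show ?thesis by (induction S rule: infinite_finite_induct) (simp_all add: that)
  qed
  show ?thesis
    using u x by (subst (1 2) alg_expand[OF v]) (simp add: F G sums)
qed

lemma prd_add_left: "prd P (v + w) z = prd P v z + prd P w z"
  using prd_conj_linear[of 1 v 1 w z] by simp

lemma prd_scal_left: "prd P (c *\<^sub>E v) z = eis_cnj c *\<^sub>E prd P v z"
  using prd_conj_linear[of c v 0 0 z] by simp

lemma prd_add_right: "prd P z (v + w) = prd P z v + prd P z w"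
  using prd_add_left by (simp add: prd_commute[of z])

lemma prd_scal_right: "prd P z (c *\<^sub>E v) = eis_cnj c *\<^sub>E prd P z v"
  using prd_scal_left by (simp add: prd_commute[of z])

lemma act_uu_table:
  assumes "h \<in> carrier (Aut_St C P)"
  shows "act C P h (uu_table i j) = uu_table (induced_perm C P h i) (induced_perm C P h j)"
proof -
  let ?p = "induced_perm C P h"
  have "inj ?p" "surj ?p" using bij_induced_perm[OF assms] by (auto simp: bij_def)
  then have sum: "(\<Sum>k\<in>UNIV - A. uvec (?p k)) = (\<Sum>k\<in>UNIV - ?p ` A. uvec k :: ('i, 'p) vec)" for A
    using sum.reindex[of ?p "UNIV - A" "uvec :: 'i \<Rightarrow> ('i, 'p) vec"] inj_on_subset[of ?p UNIV "UNIV - A"]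
    by (simp add: image_set_diff comp_def)
  show ?thesis
    using \<open>inj ?p\<close> sum[of "{i}"] sum[of "{i, j}"]
    by (cases "i = j") (simp_all add: uu_table_def act_scal act_add act_diff act_minus act_sum act_uvec inj_eq)
qed

lemma act_ux_table:
  assumes "h \<in> carrier (Aut_St C P)" "d \<in> octad_lifts P"
  shows "act C P h (ux_table P i d) = ux_table P (induced_perm C P h i) (h d)"
  using bij_is_inj[OF bij_induced_perm[OF assms(1)]]
  by (simp add: ux_table_def act_scal act_minus act_xvec[OF assms] induced_perm(2)[OF assms(1)]
      inj_image_mem_iff)

text \<open>
  Where the product involves \<open>\<Omega>\<close>, conjugating \<open>\<vartheta>\<close> changes its sign exactly when \<open>h\<close> negates
  \<open>\<Omega>\<close>, and the two signs cancel.
\<close>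

lemma act_xx_table:
  assumes h: "h \<in> carrier (Aut_St C P)" and d: "d \<in> octad_lifts P" "f \<in> octad_lifts P"
  shows "act C P h (xx_table P d f) = xx_table P (h d) (h f)"
proof -
  let ?p = "induced_perm C P h"
  have p: "inj ?p" "surj ?p" using bij_induced_perm[OF h] by (auto simp: bij_def)
  have "inj h" using Aut_StD(1)[OF h] by (rule bij_is_inj)
  have sum: "(\<Sum>k\<in>A. uvec (?p k)) = (\<Sum>k\<in>?p ` A. uvec k :: ('i, 'p) vec)" for A
    using p(1) by (simp add: sum.reindex inj_on_subset)
  have compl: "?p ` (UNIV - A) = UNIV - ?p ` A" for A
    using p by (simp add: image_set_diff)
  have Int: "lbar P (h d) \<inter> lbar P (h f) = ?p ` (lbar P d \<inter> lbar P f)"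
    using p(1) by (simp add: induced_perm(2)[OF h] image_Int)
  have card: "card (?p ` A) = card A" for A using p(1) by (simp add: card_image inj_on_subset)
  have eq_iff: "h f = h d \<longleftrightarrow> f = d" "h f = lneg P (h d) \<longleftrightarrow> f = lneg P d"
    using \<open>inj h\<close> by (simp_all add: inj_eq flip: Aut_St_neg[OF h])
  note mult = octad_lifts_mult[OF card_coordinates d]
  have theta: "eps_conj (eps P h) eis_theta *\<^sub>E xvec P (h ((d \<cdot> f) \<cdot> lOmega P))
      = eis_theta *\<^sub>E xvec P ((h d \<cdot> h f) \<cdot> lOmega P)"
    by (simp add: Aut_StD(2)[OF h] Aut_St_Omega[OF h] eps_conj_theta neg_mult_right xvec_neg)
  show ?thesis
    unfolding xx_table_def Int card eq_iff image_is_empty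
    using mult theta
    by (simp add: act_scal act_diff act_minus act_sum act_uvec act_xvec[OF h] act_zero sum compl
        induced_perm(2)[OF h] Aut_StD(2)[OF h])
qed

lemma act_prd:
  assumes h: "h \<in> carrier (Aut_St C P)" and v: "v \<in> alg P" "w \<in> alg P"
  shows "act C P h (prd P v w) = prd P (act C P h v) (act C P h w)"
proof -
  let ?\<tau> = "\<lambda>c. eis_cnj (eps_conj (eps P h) c)"
  note lin = prd_add_left prd_scal_left prd_add_right prd_scal_right act_add act_scal eps_conj_eis_cnj
  have base: "act C P h (prd P v w) = prd P (act C P h v) (act C P h w)"
    if v: "v \<in> range uvec \<union> xvec P ` octad_lifts P" and w: "w \<in> range uvec \<union> xvec P ` octad_lifts P" for v w
    using v w
    by (auto simp: prd_uu prd_ux prd_xx act_uvec act_xvec[OF h] Aut_St_octad_lifts[OF h]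
        act_uu_table[OF h] act_ux_table[OF h] act_xx_table[OF h] prd_commute[of "xvec P d" "uvec i" for d i])
  have left: "act C P h (prd P v w) = prd P (act C P h v) (act C P h w)"
    if w: "w \<in> range uvec \<union> xvec P ` octad_lifts P" for w
    by (rule semilinear_eqI[where F = "\<lambda>v. act C P h (prd P v w)" and G = "\<lambda>v. prd P (act C P h v) (act C P h w)" and \<tau> = ?\<tau>])
      (use w v(1) base in \<open>simp_all add: lin\<close>)
  show ?thesis
    by (rule semilinear_eqI[where F = "\<lambda>w. act C P h (prd P v w)" and G = "\<lambda>w. prd P (act C P h v) (act C P h w)" and \<tau> = ?\<tau>])
      (use v(2) left in \<open>simp_all add: lin\<close>)
qed

abbreviation "act_alg h \<equiv> restrict (act C P h) (alg P)"

lemma act_alg_in_Aut_sl: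
  assumes h: "h \<in> carrier (Aut_St C P)"
  shows "act_alg h \<in> carrier (Aut_sl P)"
proof -
  let ?k = "inv\<^bsub>Aut_St C P\<^esub> h"
  have "bij_betw (act_alg h) (alg P) (alg P)"
    using act_in_alg h group.inv_closed[OF group_Aut_St h] act_inv[OF h]
    by (intro bij_betw_byWitness[where f' = "act C P ?k"]) auto
  moreover have "semilinear_on (eps_conj (eps P h)) (alg P) (act_alg h)"
    using semilinear_act semilinear_on_cong[OF alg_add alg_scal, of "act_alg h" "act C P h"] by simp
  then have "linear_on_alg P (act_alg h) \<or> conj_linear_on_alg P (act_alg h)"
    by (cases "eps P h") (simp_all add: eps_conj_def[abs_def])
  ultimately show ?thesis
    using act_prd[OF h] prd_in_alg[OF card_coordinates] by (simp add: Aut_sl_def Bij_def)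
qed

subsection \<open>Faithfulness\<close>

text \<open>
  The action determines \<open>h\<close> on the lifts of octads, and these generate the loop: a lift of a
  nonempty word is multiplied by a lift of an octad meeting the word in at least five points, which
  makes the word shorter.
\<close>

lemma Aut_St_eqI:
  assumes h: "h \<in> carrier (Aut_St C P)" and k: "k \<in> carrier (Aut_St C P)"
    and eq: "\<And>d. d \<in> octad_lifts P \<Longrightarrow> h d = k d"
  shows "h = k"
proof
  fix d
  show "h d = k d"
  proof (induction "card (lbar P d)" arbitrary: d rule: less_induct)
    case less
    show ?case
    proof (cases "lbar P d = {}")
      case True
      have one: "g (lone P) = lone P" if "g \<in> carrier (Aut_St C P)" for g
        using Aut_StD(2)[OF that, of "lone P" "lone P"] right_quotient[of "g (lone P)" "g (lone P)"]
          one_left by metis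
      have "d = lone P \<or> d = lneg P (lone P)" using True bar_kernel by (simp add: lneg_def)
      then show ?thesis using one[OF h] one[OF k] Aut_St_neg[OF h] Aut_St_neg[OF k] by auto
    next
      case False
      obtain q where q: "q \<in> C" "card q = 8" "5 \<le> card (q \<inter> lbar P d)"
        using golay_octad_meets[OF golay bar_in_code False] by blast
      obtain b where b: "lbar P b = q" using obtain_lift[OF q(1)] by blast
      have "card (lbar P (d \<cdot> b)) < card (lbar P d)"
        using card_sym_diff[of "lbar P d" q] q by (simp add: bar_mult b Int_commute)
      then have "h d \<cdot> h b = k d \<cdot> k b" using less Aut_StD(2) h k by metis
      moreover have "h b = k b" using eq q(2) b by (simp add: octad_lifts_def)
      ultimately show ?thesis using right_quotient by metis
    qed
  qed
qed

lemma xvec_eq_iff: "xvec P d = xvec P e \<longleftrightarrow> d = e"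
proof
  assume "xvec P d = xvec P e"
  then have "snd (xvec P d) d = snd (xvec P e) d" by simp
  then show "d = e" by (simp add: snd_xvec split: if_splits)
qed simp

lemma inj_on_act_alg: "inj_on act_alg (carrier (Aut_St C P))"
proof (rule inj_onI)
  fix h k assume h: "h \<in> carrier (Aut_St C P)" and k: "k \<in> carrier (Aut_St C P)"
    and eq: "act_alg h = act_alg k"
  have "h d = k d" if d: "d \<in> octad_lifts P" for d
  proof -
    have "act_alg h (xvec P d) = act_alg k (xvec P d)" using eq by simp
    then show ?thesis
      using d by (simp add: xvec_in_alg act_xvec[OF h] act_xvec[OF k] xvec_eq_iff)
  qed
  then show "h = k" by (rule Aut_St_eqI[OF h k])
qed

text \<open>
  The action is on the right, so inversion is what turns it into a homomorphism for composition of
  maps.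
\<close>

lemma act_inv_hom:
  "(\<lambda>h. act_alg (inv\<^bsub>Aut_St C P\<^esub> h)) \<in> hom (Aut_St C P) (BijGroup (alg P))"
  "(\<lambda>h. act_alg (inv\<^bsub>Aut_St C P\<^esub> h)) \<in> hom (Aut_St C P) (Aut_sl P)"
proof -
  interpret group "Aut_St C P" by (rule group_Aut_St)
  have B: "act_alg h \<in> Bij (alg P)" if "h \<in> carrier (Aut_St C P)" for h
    using act_alg_in_Aut_sl[OF that] by (simp add: Aut_sl_def)
  have "act_alg (inv\<^bsub>Aut_St C P\<^esub> (h \<otimes>\<^bsub>Aut_St C P\<^esub> k))
      = compose (alg P) (act_alg (inv\<^bsub>Aut_St C P\<^esub> h)) (act_alg (inv\<^bsub>Aut_St C P\<^esub> k))"
    if h: "h \<in> carrier (Aut_St C P)" and k: "k \<in> carrier (Aut_St C P)" for h k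
  proof -
    have "inv\<^bsub>Aut_St C P\<^esub> (h \<otimes>\<^bsub>Aut_St C P\<^esub> k) = inv\<^bsub>Aut_St C P\<^esub> h \<circ> inv\<^bsub>Aut_St C P\<^esub> k"
      using inv_mult_group[OF h k] by simp
    then show ?thesis
      using act_in_alg[OF inv_closed[OF k]]
      by (simp add: compose_def restrict_def act_comp[OF inv_closed[OF k] inv_closed[OF h]] cong: if_cong)
  qed
  then show "(\<lambda>h. act_alg (inv\<^bsub>Aut_St C P\<^esub> h)) \<in> hom (Aut_St C P) (BijGroup (alg P))"
    using B inv_closed by (auto simp: hom_def BijGroup_def simp del: Aut_St_simps)
  then show "(\<lambda>h. act_alg (inv\<^bsub>Aut_St C P\<^esub> h)) \<in> hom (Aut_St C P) (Aut_sl P)"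
    using act_alg_in_Aut_sl inv_closed by (auto simp: hom_def Aut_sl_def simp del: Aut_St_simps)
qed

lemma inj_on_act_inv: "inj_on (\<lambda>h. act_alg (inv\<^bsub>Aut_St C P\<^esub> h)) (carrier (Aut_St C P))"
proof -
  interpret group "Aut_St C P" by (rule group_Aut_St)
  show ?thesis
    using comp_inj_on[OF inv_inj inj_on_subset[OF inj_on_act_alg]] inv_closed
    by (auto simp: comp_def)
qed

lemma faithful_act_inv: "faithful_action (Aut_St C P) (alg P) (\<lambda>h. act_alg (inv\<^bsub>Aut_St C P\<^esub> h))"
  by (intro faithful_action.intro faithful_action_axioms.intro group_action.intro group_hom.intro
      group_hom_axioms.intro group_Aut_St group_BijGroup act_inv_hom(1) inj_on_act_inv)

end

theorem theorem1p6:
  fixes C :: "'i::finite set set" and P :: "('i, 'p) loop_data"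
  assumes "golay_code C" and "parker_loop C P"
  shows
    "group (Aut_St C P) \<and> group (M24 C) \<and> group (Aut_sl P)
   \<and> \<comment> \<open>\<open>2^12.M24\<close>: an extension of \<open>M24\<close> by the cocode\<close>
     (\<forall>h\<in>carrier (Aut_St C P). induced_perm C P h \<in> carrier (M24 C) \<and>
        (\<forall>d. lbar P (h d) = induced_perm C P h ` lbar P d))
   \<and> induced_perm C P \<in> epi (Aut_St C P) (M24 C)
   \<and> cocode C \<cong> (Aut_St C P)\<lparr>carrier := kernel (Aut_St C P) (M24 C) (induced_perm C P)\<rparr>
   \<and> elementary_abelian_2_group 12
       ((Aut_St C P)\<lparr>carrier := kernel (Aut_St C P) (M24 C) (induced_perm C P)\<rparr>)
   \<and> \<comment> \<open>the subgroup of index two, of shape \<open>2^11.M24\<close>\<close>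
     subgroup (carrier (Aut_St_plus C P)) (Aut_St C P)
   \<and> card (rcosets\<^bsub>Aut_St C P\<^esub> (carrier (Aut_St_plus C P))) = 2
   \<and> induced_perm C P \<in> epi (Aut_St_plus C P) (M24 C)
   \<and> elementary_abelian_2_group 11
       ((Aut_St_plus C P)\<lparr>carrier := kernel (Aut_St_plus C P) (M24 C) (induced_perm C P)\<rparr>)
   \<and> \<comment> \<open>right action by semilinear algebra automorphisms\<close>
     (\<forall>h\<in>carrier (Aut_St C P). restrict (act C P h) (alg P) \<in> carrier (Aut_sl P))
   \<and> (\<forall>v\<in>alg P. act C P \<one>\<^bsub>Aut_St C P\<^esub> v = v)
   \<and> (\<forall>h\<in>carrier (Aut_St C P). \<forall>k\<in>carrier (Aut_St C P). \<forall>v\<in>alg P.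
        act C P (h \<otimes>\<^bsub>Aut_St C P\<^esub> k) v = act C P k (act C P h v))
   \<and> \<comment> \<open>faithfulness, and the embedding for composition of maps\<close>
     inj_on (\<lambda>h. restrict (act C P h) (alg P)) (carrier (Aut_St C P))
   \<and> faithful_action (Aut_St C P) (alg P)
       (\<lambda>h. restrict (act C P (inv\<^bsub>Aut_St C P\<^esub> h)) (alg P))
   \<and> (\<lambda>h. restrict (act C P (inv\<^bsub>Aut_St C P\<^esub> h)) (alg P)) \<in> mon (Aut_St C P) (Aut_sl P)
   \<and> \<comment> \<open>linear and conjugate-linear elements\<close>
     (\<forall>h\<in>carrier (Aut_St_plus C P). linear_on_alg P (act C P h))
   \<and> (\<forall>h\<in>carrier (Aut_St C P) - carrier (Aut_St_plus C P). conj_linear_on_alg P (act C P h))"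
proof -
  interpret parker_loop C P by (rule assms(2))
  interpret golay_parker_loop C P by unfold_locales (rule assms(1))
  have "linear_on_alg P (act C P h)" if "h \<in> carrier (Aut_St_plus C P)" for h
    using semilinear_act[of h "alg P"] that by (simp add: Aut_St_plus_def eps_conj_def[abs_def])
  moreover have "conj_linear_on_alg P (act C P h)"
    if "h \<in> carrier (Aut_St C P) - carrier (Aut_St_plus C P)" for h
    using semilinear_act[of h "alg P"] that by (simp add: Aut_St_plus_def eps_conj_def[abs_def])
  moreover have "act C P \<one>\<^bsub>Aut_St C P\<^esub> v = v" if "v \<in> alg P" for v
    using act_id[OF that] by simp
  moreover have "act C P (h \<otimes>\<^bsub>Aut_St C P\<^esub> k) v = act C P k (act C P h v)"
    if "h \<in> carrier (Aut_St C P)" "k \<in> carrier (Aut_St C P)" for h k v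
    using act_comp[OF that] by simp
  moreover have "(\<lambda>h. act_alg (inv\<^bsub>Aut_St C P\<^esub> h)) \<in> mon (Aut_St C P) (Aut_sl P)"
    using act_inv_hom(2) inj_on_act_inv by (simp add: mon_def)
  ultimately show ?thesis
    using group_Aut_St group_M24 group_Aut_sl induced_perm induced_perm_epi cocode_iso
      elementary_abelian_sign_group Aut_St_plus_index_two induced_perm_epi_plus
      elementary_abelian_sign_group_plus act_alg_in_Aut_sl inj_on_act_alg faithful_act_inv
    by (intro conjI ballI allI) assumption+
qed

end
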